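(* Let $k\ge1$ be an integer. Every $u\in\mathcal U^{(3),k}(\Omega)$ can be written uniquely as $u=\nabla\cdot w+\lambda$ with $w\in\mathcal U^{(2),k}_{0,\mathrm{div}}(\Omega)$ and $\lambda\in\mathbb R$.
   Context: Finite pyramid: $\Omega=\{(\xi,\eta,\zeta)\in\mathbb R^3:\xi,\eta,\zeta\ge0,\ \xi\le1-\zeta,\ \eta\le1-\zeta\}$. Infinite pyramid: $\Omega_\infty=\{(x,y,z): 0\le x,y\le1,\ z\ge0\}$. Map: $\phi:\Omega_\infty\to\Omega$, $\phi(x,y,z)=\left(\frac{x}{1+z},\frac{y}{1+z},\frac{z}{1+z}\right)$, a diffeomorphism onto $\Omega$ minus its apex $(0,0,1)$. Pullbacks: 2-forms (vector fields) $\phi^*v=|D\phi|D\phi^{-1}(v\circ\phi)$; 3-forms (scalar functions) $\phi^*q=|D\phi|(q\circ\phi)$, $|D\phi|=(1+z)^{-4}$ being the Jacobian determinant; $(\phi^{-1})^*=(\phi^* )^{-1}$. $Q^{l,m,n}_k$ is the space of functions $u/(1+z)^k$ with $u$ a polynomial of degree at most $l,m,n$ in $x,y,z$; polynomial spaces with a negative degree are $\{0\}$. Subscripts $x,y$ on $r,s,t$ denote partial derivatives. $\mathcal U^{(3),k}(\Omega)=(\phi^{-1})^*Q_{k+3}^{k-1,k-1,k-1}$ (3-form pullback). $\mathcal U^{(2),k}_{0,\mathrm{div}}(\Omega)$ is the image under the 2-form pullback $(\phi^{-1})^*$ of the space of fields $$\tfrac{z^{k-1}}{(1+z)^{k+2}}\big(r_y+2t,\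 r_x+2s,\ (1+z)(r_{xy}+s_y+t_x)\big)^T+(0,0,z\chi_3)^T$$ with $r=x(1-x)y(1-y)p$, $p\in Q^{k-2,k-2}[x,y]$; $t=x(1-x)\tilde t$, $\tilde t\in P^{k-2}(x)$; $s=y(1-y)\tilde s$, $\tilde s\in P^{k-2}(y)$; $\chi_3\in Q_{k+2}^{k-1,k-1,k-2}$. *)

theory Defs
  imports "HOL-Analysis.Analysis"
begin

section \<open>The pyramids and the map between them\<close>

definition pyramid :: "(real^3) set" where
  "pyramid = {q. 0 \<le> q$1 \<and> 0 \<le> q$2 \<and> 0 \<le> q$3 \<and> q$1 \<le> 1 - q$3 \<and> q$2 \<le> 1 - q$3}"

definition apex :: "real^3" where
  "apex = vector [0, 0, 1]"

definition inf_pyramid :: "(real^3) set" where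
  "inf_pyramid = {p. 0 \<le> p$1 \<and> p$1 \<le> 1 \<and> 0 \<le> p$2 \<and> p$2 \<le> 1 \<and> 0 \<le> p$3}"

definition phi :: "real^3 \<Rightarrow> real^3" where
  "phi p = vector [p$1 / (1 + p$3), p$2 / (1 + p$3), p$3 / (1 + p$3)]"

text \<open>The formula for \<^const>\<open>phi\<close> is smooth in a neighbourhood of \<^const>\<open>inf_pyramid\<close>, so the
  derivative may be taken in the whole space, also at boundary points.\<close>

definition Dphi :: "real^3 \<Rightarrow> real^3^3" where
  "Dphi p = matrix (frechet_derivative phi (at p))"

section \<open>Pullbacks\<close>

text \<open>Since \<^const>\<open>phi\<close> does not reach the apex, fields on the finite pyramid are functions on
  \<open>pyramid - {apex}\<close>. In order that equality of HOL functions is equality of fields, a field on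
  \<open>A\<close> is an element of \<open>extensional A\<close>.\<close>

definition pullback2 :: "(real^3 \<Rightarrow> real^3) \<Rightarrow> real^3 \<Rightarrow> real^3" where
  "pullback2 v = (\<lambda>p\<in>inf_pyramid. det (Dphi p) *\<^sub>R (matrix_inv (Dphi p) *v v (phi p)))"

definition pullback3 :: "(real^3 \<Rightarrow> real) \<Rightarrow> real^3 \<Rightarrow> real" where
  "pullback3 q = (\<lambda>p\<in>inf_pyramid. det (Dphi p) * q (phi p))"

text \<open>The pullbacks by the inverse of \<^const>\<open>phi\<close>, i.e. the inverse maps of the two pullbacks
  (which are bijective, see \<open>bij_betw_pullback2\<close> and \<open>bij_betw_pullback3\<close> below).\<close>

definition inv_pullback2 :: "(real^3 \<Rightarrow> real^3) \<Rightarrow> real^3 \<Rightarrow> real^3" where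
  "inv_pullback2 = inv_into (extensional (pyramid - {apex})) pullback2"

definition inv_pullback3 :: "(real^3 \<Rightarrow> real) \<Rightarrow> real^3 \<Rightarrow> real" where
  "inv_pullback3 = inv_into (extensional (pyramid - {apex})) pullback3"

section \<open>Polynomial and rational function spaces\<close>

text \<open>The degree bounds are integers: for a negative bound the sum is empty and the space is
  \<open>{0}\<close>.\<close>

definition poly1 :: "int \<Rightarrow> (real \<Rightarrow> real) set" where
  "poly1 l = {u. \<exists>c. u = (\<lambda>x. \<Sum>i | int i \<le> l. c i * x ^ i)}"

definition poly2 :: "int \<Rightarrow> int \<Rightarrow> (real \<Rightarrow> real \<Rightarrow> real) set" where
  "poly2 l m = {u. \<exists>c. u = (\<lambda>x y. \<Sum>i | int i \<le> l. \<Sum>j | int j \<le> m. c i j * x ^ i * y ^ j)}"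

definition poly3 :: "int \<Rightarrow> int \<Rightarrow> int \<Rightarrow> (real \<Rightarrow> real \<Rightarrow> real \<Rightarrow> real) set" where
  "poly3 l m n = {u. \<exists>c. u = (\<lambda>x y z. \<Sum>i | int i \<le> l. \<Sum>j | int j \<le> m. \<Sum>h | int h \<le> n.
     c i j h * x ^ i * y ^ j * z ^ h)}"

definition Qspace :: "nat \<Rightarrow> int \<Rightarrow> int \<Rightarrow> int \<Rightarrow> (real \<Rightarrow> real \<Rightarrow> real \<Rightarrow> real) set" where
  "Qspace k l m n = {(\<lambda>x y z. u x y z / (1 + z) ^ k) | u. u \<in> poly3 l m n}"

section \<open>The approximation spaces\<close>

definition U3 :: "nat \<Rightarrow> (real^3 \<Rightarrow> real) set" where
  "U3 k = inv_pullback3 `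
     {(\<lambda>p\<in>inf_pyramid. f (p$1) (p$2) (p$3)) | f.
        f \<in> Qspace (k + 3) (int k - 1) (int k - 1) (int k - 1)}"

definition partial_x :: "(real \<Rightarrow> real \<Rightarrow> real) \<Rightarrow> real \<Rightarrow> real \<Rightarrow> real" where
  "partial_x r x y = deriv (\<lambda>x'. r x' y) x"

definition partial_y :: "(real \<Rightarrow> real \<Rightarrow> real) \<Rightarrow> real \<Rightarrow> real \<Rightarrow> real" where
  "partial_y r x y = deriv (\<lambda>y'. r x y') y"

definition div_field ::
  "nat \<Rightarrow> (real \<Rightarrow> real \<Rightarrow> real) \<Rightarrow> (real \<Rightarrow> real) \<Rightarrow> (real \<Rightarrow> real) \<Rightarrow>
    (real \<Rightarrow> real \<Rightarrow> real \<Rightarrow> real) \<Rightarrow> real^3 \<Rightarrow> real^3" where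
  "div_field k r s t \<chi>3 = (\<lambda>p\<in>inf_pyramid. let x = p$1; y = p$2; z = p$3 in
     (z ^ (k - 1) / (1 + z) ^ (k + 2)) *\<^sub>R
       vector [partial_y r x y + 2 * t x,
               partial_x r x y + 2 * s y,
               (1 + z) * (partial_y (partial_x r) x y + deriv s y + deriv t x)]
     + vector [0, 0, z * \<chi>3 x y z])"

definition U2_0div :: "nat \<Rightarrow> (real^3 \<Rightarrow> real^3) set" where
  "U2_0div k = inv_pullback2 `
     {div_field k r s t \<chi>3 | r s t \<chi>3.
        (\<exists>p \<in> poly2 (int k - 2) (int k - 2). r = (\<lambda>x y. x * (1 - x) * y * (1 - y) * p x y)) \<and>
        (\<exists>s' \<in> poly1 (int k - 2). s = (\<lambda>y. y * (1 - y) * s' y)) \<and>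
        (\<exists>t' \<in> poly1 (int k - 2). t = (\<lambda>x. x * (1 - x) * t' x)) \<and>
        \<chi>3 \<in> Qspace (k + 2) (int k - 1) (int k - 1) (int k - 2)}"

section \<open>Divergence\<close>

text \<open>The derivative is the Frechet derivative relative to the domain: at boundary points of the
  pyramid the coordinate directions need not point into the domain, so partial derivatives
  relative to the domain would not do, whereas the relative Frechet derivative is unique
  (\<open>divergence_eqI\<close>).\<close>

definition divergence :: "(real^3 \<Rightarrow> real^3) \<Rightarrow> real^3 \<Rightarrow> real" where
  "divergence w q = trace (matrix (frechet_derivative w (at q within pyramid - {apex})))"

section \<open>Well-definedness\<close>

lemma has_derivative_phi:
  assumes "1 + p$3 \<noteq> 0"
  shows "(phi has_derivative (\<lambda>h. vector
    [h$1 / (1 + p$3) - p$1 * h$3 / (1 + p$3)\<^sup>2,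
     h$2 / (1 + p$3) - p$2 * h$3 / (1 + p$3)\<^sup>2,
     h$3 / (1 + p$3)\<^sup>2])) (at p)"
proof -
  have nth: "((\<lambda>p. p$i) has_derivative (\<lambda>h. h$i)) (at p)" for i :: 3
    by (rule bounded_linear_imp_has_derivative) (rule bounded_linear_vec_nth)
  have quot: "((\<lambda>p. p$i / (1 + p$3)) has_derivative
    (\<lambda>h. h$i / (1 + p$3) - p$i * h$3 / (1 + p$3)\<^sup>2)) (at p)" for i :: 3
  proof -
    have g: "((\<lambda>p. 1 + p$3) has_derivative (\<lambda>h. h$3)) (at p)"
      using has_derivative_add[OF has_derivative_const nth] by simp
    show ?thesis
      by (rule has_derivative_eq_rhs[OF has_derivative_divide'[OF nth g assms]])
        (use assms in \<open>simp add: fun_eq_iff power2_eq_square diff_divide_distrib\<close>)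
  qed
  have third: "h$3 / (1 + p$3) - p$3 * h$3 / (1 + p$3)\<^sup>2 = h$3 / (1 + p$3)\<^sup>2" for h :: "real^3"
  proof -
    have "h$3 / (1 + p$3) = h$3 * (1 + p$3) / (1 + p$3)\<^sup>2"
      using assms by (simp add: power2_eq_square)
    then show ?thesis by (simp add: distrib_left add_divide_distrib mult.commute)
  qed
  have comp: "((\<lambda>x. phi x \<bullet> b) has_derivative (\<lambda>h. (vector
    [h$1 / (1 + p$3) - p$1 * h$3 / (1 + p$3)\<^sup>2,
     h$2 / (1 + p$3) - p$2 * h$3 / (1 + p$3)\<^sup>2,
     h$3 / (1 + p$3)\<^sup>2] :: real^3) \<bullet> b)) (at p)" if bB: "b \<in> Basis" for b :: "real^3"
  proof -
    obtain i where b: "b = axis i 1" using bB by (auto simp: Basis_vec_def)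
    consider "i = 1" | "i = 2" | "i = 3" using exhaust_3 by blast
    then show ?thesis
    proof cases
      case 1
      show ?thesis unfolding b 1 phi_def using quot[of 1] by (simp add: inner_axis)
    next
      case 2
      show ?thesis unfolding b 2 phi_def using quot[of 2] by (simp add: inner_axis)
    next
      case 3
      show ?thesis unfolding b 3 phi_def using quot[of 3] by (simp add: inner_axis third)
    qed
  qed
  then show ?thesis
    by (subst has_derivative_componentwise_within) blast
qed

lemma det_Dphi:
  assumes "1 + p$3 \<noteq> 0"
  shows "det (Dphi p) = 1 / (1 + p$3) ^ 4"
proof -
  have *: "frechet_derivative phi (at p) = (\<lambda>h. vector
    [h$1 / (1 + p$3) - p$1 * h$3 / (1 + p$3)\<^sup>2,
     h$2 / (1 + p$3) - p$2 * h$3 / (1 + p$3)\<^sup>2,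
     h$3 / (1 + p$3)\<^sup>2])"
    using frechet_derivative_at[OF has_derivative_phi[OF assms]] by simp
  show ?thesis
    using assms
    by (simp add: Dphi_def * matrix_def det_3 axis_def power2_eq_square power4_eq_xxxx)
qed

lemma bij_betw_phi: "bij_betw phi inf_pyramid (pyramid - {apex})"
proof (rule bij_betwI[where g = "\<lambda>q. vector [q$1 / (1 - q$3), q$2 / (1 - q$3), q$3 / (1 - q$3)]"])
  show "phi \<in> inf_pyramid \<rightarrow> pyramid - {apex}"
  proof
    fix p :: "real^3" assume p: "p \<in> inf_pyramid"
    then have pos: "1 + p$3 > 0" by (simp add: inf_pyramid_def)
    then have "1 - p$3 / (1 + p$3) = 1 / (1 + p$3)" by (simp add: field_simps)
    then show "phi p \<in> pyramid - {apex}"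
      using p pos by (auto simp: phi_def inf_pyramid_def pyramid_def apex_def vec_eq_iff forall_3
        divide_right_mono)
  qed
  have lt: "q$3 < 1" if "q \<in> pyramid - {apex}" for q
    using that by (force simp: pyramid_def apex_def vec_eq_iff forall_3)
  then show "(\<lambda>q. vector [q$1 / (1 - q$3), q$2 / (1 - q$3), q$3 / (1 - q$3)])
      \<in> pyramid - {apex} \<rightarrow> inf_pyramid"
    by (auto simp: inf_pyramid_def pyramid_def field_simps)
  show "vector [phi p$1 / (1 - phi p$3), phi p$2 / (1 - phi p$3), phi p$3 / (1 - phi p$3)] = p"
    if "p \<in> inf_pyramid" for p
  proof -
    have pos: "1 + p$3 > 0" using that by (simp add: inf_pyramid_def)
    then have "1 - p$3 / (1 + p$3) = 1 / (1 + p$3)" by (simp add: field_simps)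
    then show ?thesis using pos by (simp add: phi_def vec_eq_iff forall_3)
  qed
  show "phi (vector [q$1 / (1 - q$3), q$2 / (1 - q$3), q$3 / (1 - q$3)]) = q"
    if "q \<in> pyramid - {apex}" for q
  proof -
    have pos: "1 - q$3 > 0" using lt[OF that] by simp
    then have "1 + q$3 / (1 - q$3) = 1 / (1 - q$3)" by (simp add: field_simps)
    then show ?thesis using pos by (simp add: phi_def vec_eq_iff forall_3)
  qed
qed

lemma bij_betw_pointwise_pullback:
  fixes L M :: "'a \<Rightarrow> 'v \<Rightarrow> 'v" and \<phi> :: "'a \<Rightarrow> 'b"
  assumes \<phi>: "bij_betw \<phi> A B"
    and inv1: "\<And>p a. p \<in> A \<Longrightarrow> L p (M p a) = a" and inv2: "\<And>p a. p \<in> A \<Longrightarrow> M p (L p a) = a"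
  shows "bij_betw (\<lambda>v. \<lambda>p\<in>A. L p (v (\<phi> p))) (extensional B) (extensional A)"
proof -
  let ?g = "inv_into A \<phi>"
  have g: "?g q \<in> A" "\<phi> (?g q) = q" if "q \<in> B" for q
    using that \<phi> by (auto simp: bij_betw_def inv_into_into f_inv_into_f)
  have g': "?g (\<phi> p) = p" "\<phi> p \<in> B" if "p \<in> A" for p
    using that \<phi> by (auto simp: bij_betw_def)
  show ?thesis
    by (rule bij_betwI[where g = "\<lambda>u. \<lambda>q\<in>B. M (?g q) (u (?g q))"])
      (auto simp: extensional_def g g' inv1 inv2 fun_eq_iff restrict_def)
qed

lemma bij_betw_pullback3:
  "bij_betw pullback3 (extensional (pyramid - {apex})) (extensional inf_pyramid)"
proof -
  have "bij_betw (\<lambda>v. \<lambda>p\<in>inf_pyramid. det (Dphi p) * v (phi p))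
      (extensional (pyramid - {apex})) (extensional inf_pyramid)"
    by (rule bij_betw_pointwise_pullback[where M = "\<lambda>p a. a / det (Dphi p)"])
      (use bij_betw_phi in \<open>auto simp: det_Dphi inf_pyramid_def\<close>)
  then show ?thesis by (simp add: pullback3_def[abs_def])
qed

lemma bij_betw_pullback2:
  "bij_betw pullback2 (extensional (pyramid - {apex})) (extensional inf_pyramid)"
proof -
  have inv: "Dphi p ** matrix_inv (Dphi p) = mat 1" "matrix_inv (Dphi p) ** Dphi p = mat 1"
    "det (Dphi p) \<noteq> 0" if "p \<in> inf_pyramid" for p
  proof -
    show "det (Dphi p) \<noteq> 0" using that by (auto simp: det_Dphi inf_pyramid_def)
    then have "invertible (Dphi p)" by (simp add: invertible_det_nz)
    then show "Dphi p ** matrix_inv (Dphi p) = mat 1" "matrix_inv (Dphi p) ** Dphi p = mat 1"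
      unfolding invertible_def matrix_inv_def by (metis (mono_tags, lifting) someI_ex)+
  qed
  have "bij_betw (\<lambda>v. \<lambda>p\<in>inf_pyramid. det (Dphi p) *\<^sub>R (matrix_inv (Dphi p) *v v (phi p)))
      (extensional (pyramid - {apex})) (extensional inf_pyramid)"
    by (rule bij_betw_pointwise_pullback[where M = "\<lambda>p a. inverse (det (Dphi p)) *\<^sub>R (Dphi p *v a)"])
      (auto simp: bij_betw_phi inv matrix_vector_mult_scaleR matrix_vector_mul_assoc)
  then show ?thesis by (simp add: pullback2_def[abs_def])
qed

lemma convex_pyramid_minus_apex: "convex (pyramid - {apex})"
proof (rule convexI)
  fix a b :: "real^3" and u v :: real
  assume a: "a \<in> pyramid - {apex}" and b: "b \<in> pyramid - {apex}"
    and uv: "0 \<le> u" "0 \<le> v" "u + v = 1"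
  have *: "pyramid - {apex} = {q. 0 \<le> q$1 \<and> 0 \<le> q$2 \<and> 0 \<le> q$3 \<and> q$1 + q$3 \<le> 1 \<and> q$2 + q$3 \<le> 1 \<and> q$3 < 1}"
    by (force simp: pyramid_def apex_def vec_eq_iff forall_3)
  have le: "u * s + v * t \<le> 1" if "s \<le> 1" "t \<le> 1" for s t :: real
    using that uv convex_bound_le by blast
  have lt: "u * s + v * t < 1" if "s < 1" "t < 1" for s t :: real
    using that uv convex_bound_lt by blast
  show "u *\<^sub>R a + v *\<^sub>R b \<in> pyramid - {apex}"
    using a b uv le[of "a$1 + a$3" "b$1 + b$3"] le[of "a$2 + a$3" "b$2 + b$3"] lt[of "a$3" "b$3"]
    unfolding * by (simp add: algebra_simps)
qed

lemma has_derivative_pyramid_unique: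
  fixes w :: "real^3 \<Rightarrow> real^3"
  assumes q: "q \<in> pyramid - {apex}"
    and D: "(w has_derivative D) (at q within pyramid - {apex})"
    and D': "(w has_derivative D') (at q within pyramid - {apex})"
  shows "D = D'"
proof -
  let ?S = "pyramid - {apex}"
  let ?L = "\<lambda>h. D h - D' h"
  have L: "((\<lambda>x. 0) has_derivative ?L) (at q within ?S)"
    using has_derivative_diff[OF D D'] by simp
  then interpret bounded_linear ?L by (rule has_derivative_bounded_linear)
  have seg: "?L (a - q) = 0" if a: "a \<in> ?S" for a
  proof -
    let ?g = "\<lambda>t. q + t *\<^sub>R (a - q)"
    have "?g t = (1 - t) *\<^sub>R q + t *\<^sub>R a" for t by (simp add: algebra_simps)
    then have im: "?g ` {0..1} \<subseteq> ?S"
      using convexD[OF convex_pyramid_minus_apex q a] by auto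
    have g: "(?g has_derivative (\<lambda>t. t *\<^sub>R (a - q))) (at 0 within {0..1})"
      by (auto intro!: derivative_eq_intros)
    have "((\<lambda>x. 0) has_derivative ?L) (at (?g 0) within ?g ` {0..1})"
      using has_derivative_subset[OF L im] by simp
    from diff_chain_within[OF g this]
    have "((\<lambda>t. 0) has_derivative (\<lambda>t. t *\<^sub>R ?L (a - q))) (at 0 within {0..1})"
      unfolding o_def by (simp only: scaleR)
    then have "((\<lambda>t. 0) has_vector_derivative ?L (a - q)) (at 0 within {0..1})"
      by (simp add: has_vector_derivative_def)
    moreover have "((\<lambda>t. 0::real^3) has_vector_derivative 0) (at 0 within {0..1})"
      by simp
    ultimately show ?thesis
      using vector_derivative_unique_within_closed_interval[of 0 1 0 "\<lambda>t. 0::real^3" "?L (a - q)" 0]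
      by simp
  qed
  have eq: "?L a = ?L q" if "a \<in> ?S" for a
    using seg[OF that] diff[of a q] by simp
  have in_S: "0 \<in> ?S" "axis 1 1 \<in> ?S" "axis 2 1 \<in> ?S" "(1/2) *\<^sub>R axis 3 1 \<in> ?S"
    by (auto simp: pyramid_def apex_def axis_def vec_eq_iff forall_3)
  have "?L q = 0" using eq[OF in_S(1)] zero by simp
  then have "?L (axis 1 1) = 0" "?L (axis 2 1) = 0" "?L ((1/2) *\<^sub>R axis 3 1) = 0"
    using eq in_S by metis+
  then have ax: "?L (axis 1 1) = 0" "?L (axis 2 1) = 0" "?L (axis 3 1) = 0"
    using scaleR[of "1/2" "axis 3 1"] by auto
  have "?L h = 0" for h
  proof -
    have "h = h$1 *\<^sub>R axis 1 1 + h$2 *\<^sub>R axis 2 1 + h$3 *\<^sub>R axis 3 1"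
      by (simp add: vec_eq_iff forall_3 axis_def)
    then have "?L h = h$1 *\<^sub>R ?L (axis 1 1) + h$2 *\<^sub>R ?L (axis 2 1) + h$3 *\<^sub>R ?L (axis 3 1)"
      by (metis (no_types, lifting) add scaleR)
    then show ?thesis by (simp only: ax) simp
  qed
  then show ?thesis by (auto simp: fun_eq_iff)
qed

lemma divergence_eqI:
  assumes "q \<in> pyramid - {apex}" and "(w has_derivative D) (at q within pyramid - {apex})"
  shows "divergence w q = (\<Sum>i\<in>UNIV. D (axis i 1) $ i)"
proof -
  have "frechet_derivative w (at q within pyramid - {apex}) = D"
    using assms has_derivative_pyramid_unique
    by (metis differentiableI frechet_derivative_works)
  then show ?thesis by (simp add: divergence_def trace_def matrix_def)
qed

end

theory Submission
  imports Defs
begin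

text \<open>Write \<open>k = n + 1\<close>. By the Piola identity the divergence commutes with the pullbacks, so the
  equation can be solved on the infinite pyramid. There both sides are of the form
  \<open>(\<Sum>j\<le>n. f\<^sub>j(x, y) z^j) / (1 + z)^(n + 4)\<close>, and comparing the \<open>f\<^sub>j\<close> gives, with
  \<open>A = r\<^sub>x\<^sub>y + s\<^sub>y + t\<^sub>x\<close> and with \<open>e\<^sub>j\<close> the coefficients of the numerator of \<open>\<chi>\<^sub>3\<close>,
  \<open>f\<^sub>j = (j + 1) e\<^sub>j - (n + 3 - j) e\<^sub>j\<^sub>-\<^sub>1 + n ([j = n - 1] + [j = n]) A + \<lambda> (n choose j)\<close>.
  The weights \<open>j! (n + 2 - j)!\<close>, which up to a factor are the integrals of \<open>z^j / (1 + z)^(n + 4)\<close>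
  over \<open>z \<ge> 0\<close>, eliminate the \<open>e\<^sub>j\<close> and leave \<open>L A + K \<lambda> = g(x, y)\<close> with \<open>K > 0\<close>, and \<open>L > 0\<close> for \<open>n > 0\<close>.
  Now \<open>A\<close> is the mixed derivative of \<open>F = r + x s + y t\<close>, which vanishes on \<open>x = 0\<close>, on \<open>y = 0\<close> and
  at \<open>(1, 1)\<close>; so \<open>A\<close> ranges bijectively over the polynomials with mean value zero on the unit
  square. The mean value of \<open>g\<close> determines \<open>\<lambda>\<close>, then \<open>A\<close> is determined, and the \<open>e\<^sub>j\<close> follow recursively.\<close>

section \<open>The equations in the vertical variable\<close>

definition wt :: "nat \<Rightarrow> nat \<Rightarrow> real" where
  "wt n j = fact j * fact (n + 2 - j)"

text \<open>Multiplication by \<open>(1 + z)^(n + 4)\<close> turns the derivative of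
  \<open>z (\<Sum>h<n. e h * z^h) / (1 + z)^(n + 3)\<close> into the polynomial with coefficients \<open>zdiv n e\<close>.\<close>

definition zdiv :: "nat \<Rightarrow> (nat \<Rightarrow> real) \<Rightarrow> nat \<Rightarrow> real" where
  "zdiv n e j = (real j + 1) * e j -
     (case j of 0 \<Rightarrow> 0 | Suc i \<Rightarrow> (real n + 2 - real i) * e i)"

lemma wt_pos: "wt n j > 0"
  by (simp add: wt_def)

lemma wt_Suc: "m \<le> n + 1 \<Longrightarrow> (real n + 2 - real m) * wt n (Suc m) = (real m + 1) * wt n m"
proof -
  assume "m \<le> n + 1"
  then have "n + 2 - m = Suc (n + 2 - Suc m)" "real (n + 2 - m) = real n + 2 - real m" by auto
  then show ?thesis unfolding wt_def
    by (metis (no_types, lifting) fact_Suc mult.assoc mult.commute mult.left_commute of_nat_Suc add.commute)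
qed

text \<open>The weighted sum telescopes: by \<open>wt_Suc\<close> the negative part of the term
  \<open>Suc m\<close> cancels the value of the sum up to \<open>m\<close>. For \<open>m = n\<close>
  this is the discrete form of integrating a derivative in z: only a boundary term with
  \<open>e n\<close> is left.\<close>

lemma sum_wt_zdiv:
  "m \<le> n + 1 \<Longrightarrow> (\<Sum>j\<le>m. wt n j * zdiv n e j) = (real m + 1) * wt n m * e m"
proof (induction m)
  case 0
  show ?case by (simp add: zdiv_def)
next
  case (Suc m)
  have "wt n (Suc m) * zdiv n e (Suc m) =
    (real (Suc m) + 1) * wt n (Suc m) * e (Suc m) - ((real n + 2 - real m) * wt n (Suc m)) * e m"
    by (simp add: zdiv_def algebra_simps)
  then show ?case using Suc by (simp add: wt_Suc)
qed

lemma zdiv_eq_0_imp: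
  assumes "\<And>j. j \<le> n \<Longrightarrow> zdiv n e j = 0" "m \<le> n"
  shows "e m = 0"
  using sum_wt_zdiv[of m n e] assms wt_pos[of n m] by simp

text \<open>Solving \<open>sum_wt_zdiv\<close> for \<open>e m\<close> leaves a single candidate. The
  hypothesis says exactly that this candidate has \<open>e n = 0\<close>, so that it is the
  numerator of an admissible third component.\<close>

lemma zdiv_surj:
  assumes "(\<Sum>j\<le>n. wt n j * g j) = 0"
  shows "\<exists>e. e n = 0 \<and> (\<forall>j\<le>n. zdiv n e j = g j)"
proof -
  define e where "e m = (\<Sum>j\<le>m. wt n j * g j) / ((real m + 1) * wt n m)" for m
  have e: "(real m + 1) * wt n m * e m = (\<Sum>j\<le>m. wt n j * g j)" for m
    using wt_pos[of n m] by (simp add: e_def)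
  have "zdiv n e j = g j" if "j \<le> n" for j
  proof (cases j)
    case 0
    then show ?thesis using e[of 0] wt_pos[of n 0] by (simp add: zdiv_def)
  next
    case (Suc i)
    have "wt n j * zdiv n e j = wt n j * g j"
      using sum_wt_zdiv[of j n e] sum_wt_zdiv[of i n e] e[of j] e[of i] that
      by (simp add: Suc)
    then show ?thesis using wt_pos[of n j] by simp
  qed
  moreover have "e n = 0" using assms by (simp add: e_def)
  ultimately show ?thesis by blast
qed

lemma zdiv_diff: "zdiv n (\<lambda>h. e h - e' h) j = zdiv n e j - zdiv n e' j"
  by (simp add: zdiv_def algebra_simps split: nat.split)

lemma zdiv_sum: "zdiv n (\<lambda>h. \<Sum>i\<in>I. e i h) j = (\<Sum>i\<in>I. zdiv n (e i) j)"
  by (cases j) (simp_all add: zdiv_def sum_distrib_left sum_subtractf)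

lemma zdiv_cmult: "zdiv n (\<lambda>h. c * e h) j = c * zdiv n e j"
  by (simp add: zdiv_def algebra_simps split: nat.split)

text \<open>The bracket is the numerator, over \<open>(1 + z) ^ (n + 4)\<close>, of the derivative
  of \<open>z ^ Suc h / (1 + z) ^ (n + 3)\<close>; collecting powers of \<open>z\<close> gives
  \<open>zdiv\<close>. A nonzero \<open>e n\<close> would leave an extra term
  \<open>(n + 1) * e n * z ^ n\<close>.\<close>

lemma sum_zdiv:
  assumes "e n = 0"
  shows "(\<Sum>j\<le>n. zdiv n e j * z ^ j) =
    (\<Sum>h<n. e h * ((real h + 1) * z ^ h - (real n + 2 - real h) * z ^ Suc h))"
proof -
  have "(\<Sum>j\<le>m. zdiv n e j * z ^ j) = (\<Sum>h<m. e h * ((real h + 1) * z ^ h - (real n + 2 - real h) * z ^ Suc h))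
    + (real m + 1) * e m * z ^ m" for m
    by (induction m) (simp_all add: zdiv_def algebra_simps)
  then show ?thesis using assms by simp
qed

section \<open>Tensor products and bubble polynomials\<close>

text \<open>Keeping the two families of functions as parameters makes a partial derivative a mere
  exchange of one family, with the coefficients unchanged.\<close>

definition tens :: "nat \<Rightarrow> (nat \<Rightarrow> nat \<Rightarrow> real) \<Rightarrow> (nat \<Rightarrow> real \<Rightarrow> real) \<Rightarrow> (nat \<Rightarrow> real \<Rightarrow> real) \<Rightarrow>
    real \<Rightarrow> real \<Rightarrow> real" where
  "tens n c f g x y = (\<Sum>i<n. \<Sum>j<n. c i j * f i x * g j y)"

definition lin :: "nat \<Rightarrow> (nat \<Rightarrow> real) \<Rightarrow> (nat \<Rightarrow> real \<Rightarrow> real) \<Rightarrow> real \<Rightarrow> real" where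
  "lin n c f x = (\<Sum>i<n. c i * f i x)"

abbreviation mon :: "nat \<Rightarrow> real \<Rightarrow> real" where "mon i x \<equiv> x ^ i"

text \<open>The bubbles span the polynomials of bounded degree that vanish at 0 and 1. Thus r is a
  \<open>tens\<close> of bubbles, and s and t are a \<open>lin\<close> of bubbles.\<close>

definition bub :: "nat \<Rightarrow> real \<Rightarrow> real" where "bub i x = x * (1 - x) * x ^ i"

text \<open>Written as a difference of consecutive terms \<open>(i + 1) * x ^ i\<close>, so that
  sums over \<open>i\<close> telescope.\<close>

definition dbub :: "nat \<Rightarrow> real \<Rightarrow> real" where
  "dbub i x = (real i + 1) * x ^ i - (real i + 2) * x ^ Suc i"

lemma bub_deriv: "(bub i has_real_derivative dbub i x) (at x)"
proof -
  have "((\<lambda>x. x ^ Suc i - x ^ Suc (Suc i)) has_real_derivative dbub i x) (at x)"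
    unfolding dbub_def by (rule derivative_eq_intros refl)+ (simp add: algebra_simps)
  moreover have "bub i = (\<lambda>x. x ^ Suc i - x ^ Suc (Suc i))"
    by (simp add: fun_eq_iff bub_def algebra_simps)
  ultimately show ?thesis by simp
qed

lemma bub_0_1 [simp]: "bub i 0 = 0" "bub i 1 = 0"
  by (simp_all add: bub_def)

lemma tens_deriv1:
  assumes "\<And>i. (f i has_real_derivative f' i x) (at x)"
  shows "((\<lambda>x. tens n c f g x y) has_real_derivative tens n c f' g x y) (at x)"
  unfolding tens_def
  by (intro DERIV_sum DERIV_cmult_right DERIV_cmult assms)

lemma tens_deriv2:
  assumes "\<And>i. (g i has_real_derivative g' i y) (at y)"
  shows "((\<lambda>y. tens n c f g x y) has_real_derivative tens n c f g' x y) (at y)"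
  unfolding tens_def
  by (intro DERIV_sum DERIV_cmult assms)

lemma lin_deriv:
  assumes "\<And>i. (f i has_real_derivative f' i x) (at x)"
  shows "(lin n c f has_real_derivative lin n c f' x) (at x)"
  unfolding lin_def[abs_def]
  by (intro DERIV_sum DERIV_cmult assms)

lemma tens_differentiable:
  fixes X Y :: "'a::real_normed_vector \<Rightarrow> real"
  assumes "\<And>i x. (f i has_real_derivative f' i x) (at x)" "\<And>i x. (g i has_real_derivative g' i x) (at x)"
    and "X differentiable at p" "Y differentiable at p"
  shows "(\<lambda>p. tens n c f g (X p) (Y p)) differentiable at p"
proof -
  have "(\<lambda>p. f i (X p)) differentiable at p" for i
    using differentiable_chain_at[OF assms(3)] assms(1) real_differentiable_def
    unfolding o_def by blast
  moreover have "(\<lambda>p. g i (Y p)) differentiable at p" for i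
    using differentiable_chain_at[OF assms(4)] assms(2) real_differentiable_def
    unfolding o_def by blast
  ultimately show ?thesis unfolding tens_def
    by (intro differentiable_sum ballI differentiable_mult differentiable_const) auto
qed

lemma lin_differentiable:
  fixes X :: "'a::real_normed_vector \<Rightarrow> real"
  assumes "\<And>i x. (f i has_real_derivative f' i x) (at x)" "X differentiable at p"
  shows "(\<lambda>p. lin n c f (X p)) differentiable at p"
proof -
  have "(\<lambda>p. f i (X p)) differentiable at p" for i
    using differentiable_chain_at[OF assms(2)] assms(1) real_differentiable_def
    unfolding o_def by blast
  then show ?thesis unfolding lin_def
    by (intro differentiable_sum ballI differentiable_mult differentiable_const) auto
qed

lemma nth_differentiable: "(\<lambda>p::real^3. p $ i) differentiable at p"
  by (rule bounded_linear_imp_differentiable) (rule bounded_linear_vec_nth)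

section \<open>The Piola identity\<close>

lemma Dphi_mult:
  assumes "1 + p$3 \<noteq> 0"
  shows "Dphi p *v h = vector
    [h$1 / (1 + p$3) - p$1 * h$3 / (1 + p$3)\<^sup>2,
     h$2 / (1 + p$3) - p$2 * h$3 / (1 + p$3)\<^sup>2,
     h$3 / (1 + p$3)\<^sup>2]"
proof -
  note D = has_derivative_phi[OF assms]
  have "linear (frechet_derivative phi (at p))"
    by (intro linear_frechet_derivative differentiableI[OF D])
  from fun_cong[OF matrix_vector_mul(2)[OF this], of h]
  have "Dphi p *v h = frechet_derivative phi (at p) h"
    by (simp only: Dphi_def)
  then show ?thesis by (simp only: frechet_derivative_at[OF D, symmetric])
qed

text \<open>This is the Piola transform; it comes from solving the pointwise formula of
  \<open>pullback2\<close>, whose determinant is \<open>1 / (1 + p$3) ^ 4\<close>.\<close>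

lemma inv_pullback2_phi:
  assumes p: "p \<in> inf_pyramid"
  shows "inv_pullback2 (restrict W inf_pyramid) (phi p) = (1 + p$3) ^ 4 *\<^sub>R (Dphi p *v W p)"
proof -
  have pos: "1 + p$3 > 0" using p by (simp add: inf_pyramid_def)
  let ?w = "inv_pullback2 (restrict W inf_pyramid)"
  have "pullback2 ?w = restrict W inf_pyramid"
    unfolding inv_pullback2_def by (rule bij_betw_inv_into_right[OF bij_betw_pullback2]) simp
  then have "pullback2 ?w p = W p" using p by simp
  then have W: "W p = (1 / (1 + p$3) ^ 4) *\<^sub>R (matrix_inv (Dphi p) *v ?w (phi p))"
    using p pos by (simp add: pullback2_def det_Dphi)
  have "invertible (Dphi p)" using pos by (simp add: invertible_det_nz det_Dphi)
  then have "Dphi p ** matrix_inv (Dphi p) = mat 1"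
    unfolding invertible_def matrix_inv_def by (metis (mono_tags, lifting) someI_ex)
  then show ?thesis
    using pos by (simp add: W matrix_vector_mult_scaleR matrix_vector_mul_assoc)
qed

lemma inv_pullback3_phi:
  assumes p: "p \<in> inf_pyramid"
  shows "inv_pullback3 (restrict f inf_pyramid) (phi p) = (1 + p$3) ^ 4 * f p"
proof -
  have pos: "1 + p$3 > 0" using p by (simp add: inf_pyramid_def)
  have "pullback3 (inv_pullback3 (restrict f inf_pyramid)) = restrict f inf_pyramid"
    unfolding inv_pullback3_def by (rule bij_betw_inv_into_right[OF bij_betw_pullback3]) simp
  then have "pullback3 (inv_pullback3 (restrict f inf_pyramid)) p = f p" using p by simp
  then show ?thesis using p pos by (simp add: pullback3_def det_Dphi field_simps)
qed

lemma has_derivative_vec3: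
  fixes f f' :: "real^3 \<Rightarrow> real^3"
  assumes "\<And>i. ((\<lambda>p. f p $ i) has_derivative (\<lambda>h. f' h $ i)) (at p within S)"
  shows "(f has_derivative f') (at p within S)"
proof -
  have "((\<lambda>x. f x \<bullet> b) has_derivative (\<lambda>h. f' h \<bullet> b)) (at p within S)" if bB: "b \<in> Basis" for b
  proof -
    obtain i where b: "b = axis i 1" using bB by (auto simp: Basis_vec_def)
    show ?thesis unfolding b using assms[of i] by (simp add: inner_axis)
  qed
  then show ?thesis
    by (subst has_derivative_componentwise_within) blast
qed

text \<open>The inverse of \<^const>\<open>phi\<close> is \<open>q / (1 - q$3)\<close>; in this form its derivative can be read
  off from that of \<^const>\<open>phi\<close>.\<close>

definition psi :: "real^3 \<Rightarrow> real^3" where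
  "psi q = - phi (- q)"

lemma psi_phi:
  assumes "1 + p$3 \<noteq> 0"
  shows "psi (phi p) = p"
proof -
  have *: "1 - p$3 / (1 + p$3) = 1 / (1 + p$3)" using assms by (simp add: field_simps)
  show ?thesis
    using assms by (simp add: psi_def phi_def vec_eq_iff forall_3 *)
qed

lemma has_derivative_psi:
  assumes p: "1 + p$3 \<noteq> 0"
  shows "(psi has_derivative (\<lambda>h. (h$1 * (1 + p$3)) *\<^sub>R axis 1 1 + (h$2 * (1 + p$3)) *\<^sub>R axis 2 1
    + (h$3 * (1 + p$3)) *\<^sub>R (p + axis 3 1))) (at (phi p))"
proof -
  have *: "1 - p$3 / (1 + p$3) = 1 / (1 + p$3)" using assms by (simp add: field_simps)
  have ph: "phi p $ 1 = p$1 / (1 + p$3)" "phi p $ 2 = p$2 / (1 + p$3)" "phi p $ 3 = p$3 / (1 + p$3)"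
    by (simp_all add: phi_def)
  have nz: "1 + (- phi p) $ 3 \<noteq> 0" using p by (simp add: ph *)
  have m: "(uminus has_derivative uminus) (at (phi p))"
    by (auto intro!: derivative_eq_intros)
  note D = has_derivative_minus[OF has_derivative_compose[OF m has_derivative_phi[OF nz]]]
  show ?thesis
    unfolding psi_def[abs_def]
    by (rule has_derivative_eq_rhs[OF D])
      (use p in \<open>simp add: fun_eq_iff vec_eq_iff forall_3 axis_def ph * field_simps power2_eq_square\<close>)
qed

text \<open>The Piola identity, by the chain rule for the transformed field composed with
  \<open>psi\<close>. In the trace the terms with \<open>W p $ 3\<close> cancel (weights -1, -1 and
  2), and so do the horizontal derivatives of the third component.\<close>

lemma divergence_inv_pullback2:
  assumes p: "p \<in> inf_pyramid" and W: "(W has_derivative W') (at p)"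
  shows "divergence (inv_pullback2 (restrict W inf_pyramid)) (phi p) =
    (1 + p$3) ^ 4 * (\<Sum>i\<in>UNIV. W' (axis i 1) $ i)"
proof -
  let ?w = "inv_pullback2 (restrict W inf_pyramid)"
  let ?S = "pyramid - {apex}"
  define D where "D = (\<lambda>h::real^3. (h$1 * (1 + p$3)) *\<^sub>R axis 1 1 + (h$2 * (1 + p$3)) *\<^sub>R axis 2 1
    + (h$3 * (1 + p$3)) *\<^sub>R (p + axis 3 1))"
  \<comment> \<open>The Piola transform \<open>(1 + p$3) ^ 4 *\<^sub>R (Dphi p *v W p)\<close> with
    the denominators cancelled, so that it makes sense on the whole space.\<close>
  define V :: "real^3 \<Rightarrow> real^3" where "V p = vector [(1 + p$3) ^ 3 * W p $ 1 - p$1 * ((1 + p$3)\<^sup>2 * W p $ 3),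
    (1 + p$3) ^ 3 * W p $ 2 - p$2 * ((1 + p$3)\<^sup>2 * W p $ 3), (1 + p$3)\<^sup>2 * W p $ 3]" for p
  define V' :: "real^3 \<Rightarrow> real^3" where "V' h = vector [
    3 * (1 + p$3)\<^sup>2 * h$3 * W p $ 1 + (1 + p$3) ^ 3 * W' h $ 1
      - (h$1 * ((1 + p$3)\<^sup>2 * W p $ 3) + p$1 * (2 * (1 + p$3) * h$3 * W p $ 3 + (1 + p$3)\<^sup>2 * W' h $ 3)),
    3 * (1 + p$3)\<^sup>2 * h$3 * W p $ 2 + (1 + p$3) ^ 3 * W' h $ 2
      - (h$2 * ((1 + p$3)\<^sup>2 * W p $ 3) + p$2 * (2 * (1 + p$3) * h$3 * W p $ 3 + (1 + p$3)\<^sup>2 * W' h $ 3)),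
    2 * (1 + p$3) * h$3 * W p $ 3 + (1 + p$3)\<^sup>2 * W' h $ 3]" for h
  have pos: "1 + p$3 \<noteq> 0" using p by (simp add: inf_pyramid_def)
  have nth [derivative_intros]: "((\<lambda>p. p$i) has_derivative (\<lambda>h. h$i)) (at p)" for i :: 3
    by (rule bounded_linear_imp_has_derivative) (rule bounded_linear_vec_nth)
  have Wnth [derivative_intros]: "((\<lambda>p. W p $ i) has_derivative (\<lambda>h. W' h $ i)) (at p)" for i :: 3
    by (rule bounded_linear.has_derivative[OF bounded_linear_vec_nth W])
  have V: "(V has_derivative V') (at p)"
  proof (rule has_derivative_vec3)
    fix i :: 3
    consider "i = 1" | "i = 2" | "i = 3" using exhaust_3 by blast
    then show "((\<lambda>p. V p $ i) has_derivative (\<lambda>h. V' h $ i)) (at p)"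
      by cases (simp_all only: V_def V'_def vector_3,
        (rule derivative_eq_intros refl | simp add: fun_eq_iff algebra_simps)+)
  qed
  have psi: "(psi has_derivative D) (at (phi p))"
    unfolding D_def by (rule has_derivative_psi[OF pos])
  have "(V has_derivative V') (at (psi (phi p)))"
    using V by (simp add: psi_phi[OF pos])
  from has_derivative_compose[OF psi this]
  have VD: "((\<lambda>q. V (psi q)) has_derivative (\<lambda>h. V' (D h))) (at (phi p) within ?S)"
    by (rule has_derivative_at_withinI)
  have S: "phi p \<in> ?S" using bij_betw_phi p by (auto simp: bij_betw_def)
  \<comment> \<open>The fields agree only on the pyramid without apex, hence the derivative is
    transferred relative to that set, as \<open>divergence\<close> requires.\<close>
  have eq: "?w q = V (psi q)" if q: "q \<in> ?S" for q
  proof -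
    obtain p' where p': "p' \<in> inf_pyramid" "q = phi p'"
      using bij_betw_phi q by (auto simp: bij_betw_def)
    then have nz: "1 + p'$3 \<noteq> 0" by (simp add: inf_pyramid_def)
    have "a ^ 4 * (b / a - x * c / a\<^sup>2) = a ^ 3 * b - x * (a\<^sup>2 * c)" "a ^ 4 * (c / a\<^sup>2) = a\<^sup>2 * c"
      if "a \<noteq> 0" for a b c x :: real
      using that by (simp_all add: right_diff_distrib power2_eq_square power3_eq_cube power4_eq_xxxx)
    note * = this[OF nz]
    show ?thesis
      unfolding p'(2) inv_pullback2_phi[OF p'(1)] psi_phi[OF nz] Dphi_mult[OF nz] V_def
      unfolding vec_eq_iff forall_3 vector_scaleR_component vector_3 real_scaleR_def *
      by simp
  qed
  have w: "(?w has_derivative (\<lambda>h. V' (D h))) (at (phi p) within ?S)"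
    by (rule has_derivative_transform[OF S eq VD])
  interpret W': bounded_linear W' by (rule has_derivative_bounded_linear[OF W])
  \<comment> \<open>The image of the third axis under \<open>D\<close> contains \<open>p\<close>
    itself, so \<open>W' p\<close> has to be expanded in partial derivatives.\<close>
  have pe: "p = p$1 *\<^sub>R axis 1 1 + p$2 *\<^sub>R axis 2 1 + p$3 *\<^sub>R axis 3 1"
    by (simp add: vec_eq_iff forall_3 axis_def)
  have W'p: "W' p = p$1 *\<^sub>R W' (axis 1 1) + p$2 *\<^sub>R W' (axis 2 1) + p$3 *\<^sub>R W' (axis 3 1)"
    by (subst pe) (simp only: W'.add W'.scaleR)
  have D: "D (axis 1 1) = (1 + p$3) *\<^sub>R axis 1 1" "D (axis 2 1) = (1 + p$3) *\<^sub>R axis 2 1"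
    "D (axis 3 1) = (1 + p$3) *\<^sub>R (p + axis 3 1)"
    by (simp_all add: D_def axis_def)
  have 1: "V' (D (axis 1 1)) $ 1 = (1 + p$3) ^ 4 * W' (axis 1 1) $ 1
      - (1 + p$3) ^ 3 * (W p $ 3 + p$1 * W' (axis 1 1) $ 3)"
    unfolding D V'_def vector_3 W'.scaleR vector_scaleR_component
    by (simp add: axis_def) algebra
  have 2: "V' (D (axis 2 1)) $ 2 = (1 + p$3) ^ 4 * W' (axis 2 1) $ 2
      - (1 + p$3) ^ 3 * (W p $ 3 + p$2 * W' (axis 2 1) $ 3)"
    unfolding D V'_def vector_3 W'.scaleR vector_scaleR_component
    by (simp add: axis_def) algebra
  have 3: "V' (D (axis 3 1)) $ 3 = (1 + p$3) ^ 4 * W' (axis 3 1) $ 3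
      + (1 + p$3) ^ 3 * (2 * W p $ 3 + p$1 * W' (axis 1 1) $ 3 + p$2 * W' (axis 2 1) $ 3)"
    unfolding D V'_def vector_3 W'.scaleR W'.add W'p vector_scaleR_component vector_add_component
    by (simp add: axis_def) algebra
  have "divergence ?w (phi p) = V' (D (axis 1 1)) $ 1 + V' (D (axis 2 1)) $ 2 + V' (D (axis 3 1)) $ 3"
    by (simp add: divergence_eqI[OF S w] sum_3)
  also have "\<dots> = (1 + p$3) ^ 4 * (W' (axis 1 1) $ 1 + W' (axis 2 1) $ 2 + W' (axis 3 1) $ 3)"
    unfolding 1 2 3 by (simp add: algebra_simps)
  finally show ?thesis by (simp add: sum_3)
qed

text \<open>Restricting \<open>W\<close> to a line parallel to an axis identifies an entry of its
  Frechet derivative with a derivative in one variable.\<close>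

lemma has_derivative_component_partial:
  fixes W :: "real^'n \<Rightarrow> real^'m"
  assumes W: "(W has_derivative W') (at p)"
    and \<gamma>: "\<And>s. \<gamma> s = p + (s - p$i) *\<^sub>R axis i 1"
    and d: "((\<lambda>s. W (\<gamma> s) $ j) has_real_derivative d) (at (p$i))"
  shows "W' (axis i 1) $ j = d"
proof -
  have \<gamma>': "(\<gamma> has_derivative (\<lambda>h. h *\<^sub>R axis i 1)) (at (p$i))"
    unfolding \<gamma> by (auto intro!: derivative_eq_intros)
  have "(W has_derivative W') (at (\<gamma> (p$i)))" using W by (simp add: \<gamma>)
  from bounded_linear.has_derivative[OF bounded_linear_vec_nth has_derivative_compose[OF \<gamma>' this]]
  have "((\<lambda>s. W (\<gamma> s) $ j) has_derivative (\<lambda>h. W' (h *\<^sub>R axis i 1) $ j)) (at (p$i))" .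
  from has_derivative_unique[OF this d[unfolded has_field_derivative_def]]
  have "W' (1 *\<^sub>R axis i 1) $ j = d" by (metis mult.right_neutral)
  then show ?thesis by simp
qed

lemma divergence_inv_pullback2_partials:
  assumes p: "p \<in> inf_pyramid" and W: "W differentiable at p"
    and d1: "((\<lambda>s. W (vector [s, p$2, p$3]) $ 1) has_real_derivative d1) (at (p$1))"
    and d2: "((\<lambda>s. W (vector [p$1, s, p$3]) $ 2) has_real_derivative d2) (at (p$2))"
    and d3: "((\<lambda>s. W (vector [p$1, p$2, s]) $ 3) has_real_derivative d3) (at (p$3))"
  shows "divergence (inv_pullback2 (restrict W inf_pyramid)) (phi p) =
    (1 + p$3) ^ 4 * (d1 + d2 + d3)"
proof -
  obtain W' where W': "(W has_derivative W') (at p)" using W by (auto simp: differentiable_def)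
  have v: "vector [s, p$2, p$3] = p + (s - p$1) *\<^sub>R axis 1 1"
    "vector [p$1, s, p$3] = p + (s - p$2) *\<^sub>R axis 2 1"
    "vector [p$1, p$2, s] = p + (s - p$3) *\<^sub>R axis 3 1" for s
    by (simp_all add: vec_eq_iff forall_3 axis_def)
  show ?thesis
    using has_derivative_component_partial[OF W' v(1) d1] has_derivative_component_partial[OF W' v(2) d2]
      has_derivative_component_partial[OF W' v(3) d3]
    by (simp add: divergence_inv_pullback2[OF p W'] sum_3)
qed

section \<open>The divergence on the infinite pyramid\<close>

text \<open>The value stays abstract: it serves the Frechet differentiability of the field, and no
  second derivative of a bubble enters the divergence.\<close>

lemma dbub_deriv: "(dbub i has_real_derivative deriv (dbub i) x) (at x)"
proof -
  have "dbub i differentiable (at x)"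
    unfolding dbub_def[abs_def] by (auto intro!: derivative_intros)
  then show ?thesis by (simp add: DERIV_deriv_iff_real_differentiable)
qed

lemma power_quotient_deriv:
  assumes z: "1 + z \<noteq> (0::real)"
  shows "((\<lambda>z. z ^ m / (1 + z) ^ N) has_real_derivative
    (real m * z ^ (m - 1) * (1 + z) - real N * z ^ m) / (1 + z) ^ Suc N) (at z)"
proof (cases N)
  case 0
  show ?thesis unfolding 0 using z by (auto intro!: derivative_eq_intros simp: divide_simps)
next
  case (Suc M)
  have num: "((\<lambda>z. z ^ m) has_real_derivative real m * z ^ (m - 1)) (at z)"
    by (auto intro!: derivative_eq_intros)
  have den: "((\<lambda>z. (1 + z) ^ N) has_real_derivative real N * (1 + z) ^ M) (at z)"
    by (rule derivative_eq_intros refl)+ (simp add: Suc)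
  have "((\<lambda>z. z ^ m / (1 + z) ^ N) has_real_derivative
    ((real m * z ^ (m - 1)) * (1 + z) ^ N - z ^ m * (real N * (1 + z) ^ M)) / ((1 + z) ^ N * (1 + z) ^ N)) (at z)"
    using DERIV_divide[OF num den] z by simp
  also have "((real m * z ^ (m - 1)) * (1 + z) ^ N - z ^ m * (real N * (1 + z) ^ M)) =
    (real m * z ^ (m - 1) * (1 + z) - real N * z ^ m) * (1 + z) ^ M"
    by (simp only: Suc power_Suc) (simp only: algebra_simps)
  also have "\<dots> / ((1 + z) ^ N * (1 + z) ^ N) = (real m * z ^ (m - 1) * (1 + z) - real N * z ^ m) / (1 + z) ^ Suc N"
    using z by (simp add: Suc)
  finally show ?thesis .
qed

text \<open>Only \<open>e h\<close> with \<open>h < n\<close> enter; the index \<open>n\<close> is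
  left free for the convention \<open>e n = 0\<close> of \<open>zdiv\<close>.\<close>

definition chi :: "nat \<Rightarrow> (nat \<Rightarrow> real \<Rightarrow> real \<Rightarrow> real) \<Rightarrow> real \<Rightarrow> real \<Rightarrow> real \<Rightarrow> real" where
  "chi n e x y z = (\<Sum>h<n. e h x y * z ^ h) / (1 + z) ^ (n + 3)"

text \<open>The function A of the introduction, with \<open>c\<close>, \<open>a\<close>,
  \<open>b\<close> the coefficients of r, s, t.\<close>

definition mixed :: "nat \<Rightarrow> (nat \<Rightarrow> nat \<Rightarrow> real) \<Rightarrow> (nat \<Rightarrow> real) \<Rightarrow> (nat \<Rightarrow> real) \<Rightarrow> real \<Rightarrow> real \<Rightarrow> real" where
  "mixed n c a b x y = tens n c dbub dbub x y + lin n a dbub y + lin n b dbub x"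

text \<open>The coefficients of \<open>n * z ^ (n - 1) * (1 + z)\<close>, the factor of A in the
  numerator of the divergence.\<close>

definition bcoef :: "nat \<Rightarrow> nat \<Rightarrow> real" where
  "bcoef n j = real n * (of_bool (Suc j = n) + of_bool (j = n))"

lemma sum_bcoef: "(\<Sum>j\<le>n. bcoef n j * z ^ j) = real n * z ^ (n - 1) * (1 + z)"
proof (cases n)
  case (Suc m)
  have "bcoef n j * z ^ j = (if j = m then real n * z ^ m else 0) + (if j = n then real n * z ^ n else 0)" for j
    by (auto simp: bcoef_def Suc)
  then show ?thesis by (simp add: sum.distrib Suc algebra_simps)
qed (simp add: bcoef_def)

text \<open>The formula of \<^const>\<open>div_field\<close> on the whole space, so that two-sided derivatives exist at
  the boundary of \<^const>\<open>inf_pyramid\<close> too. The coefficients \<open>c\<close>, \<open>a\<close>, \<open>b\<close> and \<open>e\<close> belong to \<open>r\<close>, \<open>s\<close>,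
  \<open>t\<close> and \<open>\<chi>\<^sub>3\<close>.\<close>

definition vfield :: "nat \<Rightarrow> (nat \<Rightarrow> nat \<Rightarrow> real) \<Rightarrow> (nat \<Rightarrow> real) \<Rightarrow> (nat \<Rightarrow> real) \<Rightarrow> (nat \<Rightarrow> real \<Rightarrow> real \<Rightarrow> real)
    \<Rightarrow> real^3 \<Rightarrow> real^3" where
  "vfield n c a b e p = vector
    [p$3 ^ n / (1 + p$3) ^ (n + 3) * (tens n c bub dbub (p$1) (p$2) + 2 * lin n b bub (p$1)),
     p$3 ^ n / (1 + p$3) ^ (n + 3) * (tens n c dbub bub (p$1) (p$2) + 2 * lin n a bub (p$2)),
     p$3 ^ n / (1 + p$3) ^ (n + 2) * mixed n c a b (p$1) (p$2) +
     (\<Sum>h<n. e h (p$1) (p$2) * (p$3 ^ Suc h / (1 + p$3) ^ (n + 3)))]"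

lemma div_field_eq:
  "div_field (Suc n) (tens n c bub bub) (lin n a bub) (lin n b bub) (chi n e) =
    restrict (vfield n c a b e) inf_pyramid"
proof -
  have x: "partial_x (tens n c bub bub) = tens n c dbub bub"
    by (intro ext) (simp add: partial_x_def DERIV_imp_deriv[OF tens_deriv1] bub_deriv)
  have y: "partial_y (tens n c f bub) = tens n c f dbub" for f
    by (intro ext) (simp add: partial_y_def DERIV_imp_deriv[OF tens_deriv2] bub_deriv)
  have l: "deriv (lin n a bub) y = lin n a dbub y" for a y
    by (simp add: DERIV_imp_deriv[OF lin_deriv] bub_deriv)
  \<comment> \<open>At \<open>1 + z = 0\<close> both sides are 0 by division by zero.\<close>
  have q: "z ^ n / (1 + z) ^ (n + 3) * (1 + z) = z ^ n / (1 + z) ^ (n + 2)" for z :: real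
    by (cases "1 + z = 0") (simp_all add: eval_nat_numeral)
  have q': "z ^ n / (1 + z) ^ (n + 3) * ((1 + z) * m) = z ^ n / (1 + z) ^ (n + 2) * m" for z m :: real
    by (simp only: q mult.assoc[symmetric])
  have ch: "z * chi n e x y z = (\<Sum>h<n. e h x y * (z ^ Suc h / (1 + z) ^ (n + 3)))" for x y z
    by (simp add: chi_def sum_distrib_left sum_divide_distrib mult_ac)
  have nk: "Suc n - 1 = n" "Suc n + 2 = n + 3" by simp_all
  show ?thesis
    unfolding div_field_def Let_def x y l nk
    by (intro restrict_ext, simp only: vec_eq_iff forall_3 vfield_def vector_3 vector_add_component
        vector_scaleR_component real_scaleR_def ch q' mixed_def) simp
qed

text \<open>The horizontal part contributes \<open>2 * z ^ n\<close> times A over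
  \<open>(1 + z) ^ (n + 3)\<close>, the vertical one
  \<open>n * z ^ (n - 1) * (1 + z) - (n + 2) * z ^ n\<close> times A over the same power. They add
  up to \<open>n * z ^ (n - 1)\<close> times A, and one more factor \<open>1 + z\<close> gives
  \<open>bcoef\<close>.\<close>

lemma divergence_vfield:
  assumes p: "p \<in> inf_pyramid" and e: "\<And>h. e h = tens (Suc n) (d h) mon mon" and e0: "e n (p$1) (p$2) = 0"
  shows "divergence (inv_pullback2 (restrict (vfield n c a b e) inf_pyramid)) (phi p) =
    (1 + p$3) ^ 4 * ((\<Sum>j\<le>n. (zdiv n (\<lambda>h. e h (p$1) (p$2)) j + bcoef n j * mixed n c a b (p$1) (p$2)) * p$3 ^ j)
      / (1 + p$3) ^ (n + 4))"
proof -
  define x y z where "x = p$1" "y = p$2" "z = p$3"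
  have nz: "1 + z \<noteq> 0" "1 + p$3 \<noteq> 0" using p by (simp_all add: inf_pyramid_def x_y_z_def)
  have mon: "(mon i has_real_derivative real i * x ^ (i - 1)) (at x)" for i and x :: real
    by (auto intro!: derivative_eq_intros)
  note D = bub_deriv dbub_deriv mon
  have td: "(\<lambda>p::real^3. tens n c f g (p$1) (p$2)) differentiable at p"
    if "\<And>i x. (f i has_real_derivative f' i x) (at x)" "\<And>i x. (g i has_real_derivative g' i x) (at x)"
    for n c f g f' g'
    by (rule tens_differentiable[OF that nth_differentiable nth_differentiable])
  have ld: "(\<lambda>p::real^3. lin n c f (p$i)) differentiable at p"
    if "\<And>i x. (f i has_real_derivative f' i x) (at x)" for n c f f' i
    by (rule lin_differentiable[OF that nth_differentiable])
  have zd: "(\<lambda>p::real^3. p$3 ^ m / (1 + p$3) ^ N) differentiable at p" for m N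
    using nz by (intro differentiable_divide differentiable_power differentiable_add differentiable_const
      nth_differentiable) auto
  have diff: "vfield n c a b e differentiable at p"
  proof (subst differentiable_componentwise_within, safe)
    fix u :: "real^3" assume "u \<in> Basis"
    then obtain i where u: "u = axis i 1" by (auto simp: Basis_vec_def)
    have "(\<lambda>p. vfield n c a b e p $ i) differentiable at p"
      using exhaust_3[of i]
      by (elim disjE; simp only: vfield_def vector_3 mixed_def e)
        (intro differentiable_add differentiable_mult differentiable_sum differentiable_const ballI zd
          td[OF bub_deriv dbub_deriv] td[OF dbub_deriv bub_deriv] td[OF dbub_deriv dbub_deriv]
          td[OF mon mon] ld[OF bub_deriv] ld[OF dbub_deriv] finite_lessThan)+
    then show "(\<lambda>p. vfield n c a b e p \<bullet> u) differentiable at p"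
      by (simp add: u inner_axis)
  qed
  let ?g = "z ^ n / (1 + z) ^ (n + 3)"
  let ?T = "tens n c dbub dbub x y"
  define Z1 where "Z1 = real n * z ^ (n - 1)"
  have d1: "((\<lambda>s. vfield n c a b e (vector [s, p$2, p$3]) $ 1) has_real_derivative
      ?g * (?T + 2 * lin n b dbub x)) (at (p$1))"
    unfolding vfield_def vector_3 x_y_z_def
    by (intro DERIV_cmult DERIV_add tens_deriv1 lin_deriv bub_deriv)
  have d2: "((\<lambda>s. vfield n c a b e (vector [p$1, s, p$3]) $ 2) has_real_derivative
      ?g * (?T + 2 * lin n a dbub y)) (at (p$2))"
    unfolding vfield_def vector_3 x_y_z_def
    by (intro DERIV_cmult DERIV_add tens_deriv2 lin_deriv bub_deriv)
  have d3: "((\<lambda>s. vfield n c a b e (vector [p$1, p$2, s]) $ 3) has_real_derivative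
      (Z1 * (1 + z) - real (n + 2) * z ^ n) / (1 + z) ^ Suc (n + 2) * mixed n c a b x y +
      (\<Sum>h<n. e h x y * ((real (Suc h) * z ^ (Suc h - 1) * (1 + z) - real (n + 3) * z ^ Suc h)
        / (1 + z) ^ Suc (n + 3)))) (at (p$3))"
    unfolding vfield_def vector_3 x_y_z_def Z1_def
    by (intro DERIV_add DERIV_sum DERIV_cmult DERIV_cmult_right power_quotient_deriv nz)
  have zZ1: "real n * z ^ n = z * Z1" unfolding Z1_def by (cases n) simp_all
  \<comment> \<open>The factors 2 at s and t make the horizontal part a multiple of A, since r
    contributes its mixed derivative twice.\<close>
  have eq1: "?g * (?T + 2 * lin n b dbub x) + ?g * (?T + 2 * lin n a dbub y) = 2 * ?g * mixed n c a b x y"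
    by (simp add: mixed_def algebra_simps add_divide_distrib)
  have "2 * ?g + (Z1 * (1 + z) - real (n + 2) * z ^ n) / (1 + z) ^ Suc (n + 2) =
    (2 * z ^ n + (Z1 * (1 + z) - real (n + 2) * z ^ n)) / (1 + z) ^ (n + 3)"
    by (simp add: add_divide_distrib eval_nat_numeral)
  also have "2 * z ^ n + (Z1 * (1 + z) - real (n + 2) * z ^ n) = Z1"
    using zZ1 by (simp add: algebra_simps)
  also have "Z1 / (1 + z) ^ (n + 3) = Z1 * (1 + z) / (1 + z) ^ (n + 4)"
    using nz by (simp add: eval_nat_numeral)
  finally have eq2: "2 * ?g + (Z1 * (1 + z) - real (n + 2) * z ^ n) / (1 + z) ^ Suc (n + 2)
    = Z1 * (1 + z) / (1 + z) ^ (n + 4)" .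
  have eq3: "(\<Sum>h<n. e h x y * ((real (Suc h) * z ^ (Suc h - 1) * (1 + z) - real (n + 3) * z ^ Suc h)
        / (1 + z) ^ Suc (n + 3))) = (\<Sum>j\<le>n. zdiv n (\<lambda>h. e h x y) j * z ^ j) / (1 + z) ^ (n + 4)"
    using e0 unfolding x_y_z_def[symmetric]
    by (simp add: sum_zdiv sum_divide_distrib) (intro sum.cong refl, simp add: algebra_simps)
  have eq4: "(\<Sum>j\<le>n. (zdiv n (\<lambda>h. e h x y) j + bcoef n j * mixed n c a b x y) * z ^ j) =
    (\<Sum>j\<le>n. zdiv n (\<lambda>h. e h x y) j * z ^ j) + Z1 * (1 + z) * mixed n c a b x y"
    unfolding Z1_def sum_bcoef[symmetric] by (simp add: algebra_simps sum.distrib sum_distrib_left)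
  have "?g * (?T + 2 * lin n b dbub x) + ?g * (?T + 2 * lin n a dbub y) +
      ((Z1 * (1 + z) - real (n + 2) * z ^ n) / (1 + z) ^ Suc (n + 2) * mixed n c a b x y +
      (\<Sum>h<n. e h x y * ((real (Suc h) * z ^ (Suc h - 1) * (1 + z) - real (n + 3) * z ^ Suc h)
        / (1 + z) ^ Suc (n + 3)))) =
      (2 * ?g + (Z1 * (1 + z) - real (n + 2) * z ^ n) / (1 + z) ^ Suc (n + 2)) * mixed n c a b x y +
      (\<Sum>j\<le>n. zdiv n (\<lambda>h. e h x y) j * z ^ j) / (1 + z) ^ (n + 4)"
    unfolding eq1 eq3 by (simp only: distrib_right add.assoc)
  also have "\<dots> = (\<Sum>j\<le>n. (zdiv n (\<lambda>h. e h x y) j + bcoef n j * mixed n c a b x y) * z ^ j) / (1 + z) ^ (n + 4)"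
    unfolding eq2 eq4 by (simp add: add_divide_distrib)
  finally show ?thesis
    using divergence_inv_pullback2_partials[OF p diff d1 d2 d3] by (simp only: x_y_z_def)
qed

section \<open>Solving the coefficient equations\<close>

lemma tens_diff: "tens n (\<lambda>i j. c i j - c' i j) f g x y = tens n c f g x y - tens n c' f g x y"
  by (simp add: tens_def left_diff_distrib sum_subtractf)

lemma lin_diff: "lin n (\<lambda>i. c i - c' i) f x = lin n c f x - lin n c' f x"
  by (simp add: lin_def left_diff_distrib sum_subtractf)

lemma mixed_diff: "mixed n (\<lambda>i j. c i j - c' i j) (\<lambda>i. a i - a' i) (\<lambda>i. b i - b' i) x y =
    mixed n c a b x y - mixed n c' a' b' x y"
  by (simp add: mixed_def tens_diff lin_diff)

lemma zdiv_tens: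
  "zdiv n (\<lambda>h. tens N (d h) f g x y) j = tens N (\<lambda>i l. zdiv n (\<lambda>h. d h i l) j) f g x y"
proof -
  have "zdiv n (\<lambda>h. d h i l * f i x * g l y) j = zdiv n (\<lambda>h. d h i l) j * f i x * g l y" for i l
    using zdiv_cmult[of n "f i x * g l y" "\<lambda>h. d h i l" j] by (simp add: mult_ac)
  then show ?thesis by (simp add: tens_def zdiv_sum)
qed

lemma tens_sum: "tens n (\<lambda>i j. \<Sum>s\<in>S. c s i j) f g x y = (\<Sum>s\<in>S. tens n (c s) f g x y)"
proof -
  have "tens n (\<lambda>i j. \<Sum>s\<in>S. c s i j) f g x y = (\<Sum>i<n. \<Sum>s\<in>S. \<Sum>j<n. c s i j * f i x * g j y)"
    unfolding tens_def sum_distrib_right by (intro sum.cong refl sum.swap)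
  also have "\<dots> = (\<Sum>s\<in>S. tens n (c s) f g x y)"
    unfolding tens_def by (rule sum.swap)
  finally show ?thesis .
qed

lemma lin_sum: "lin n (\<lambda>i. \<Sum>s\<in>S. c s i) f x = (\<Sum>s\<in>S. lin n (c s) f x)"
  unfolding lin_def sum_distrib_right by (rule sum.swap)

lemma tens_prod: "tens n (\<lambda>i j. k * p i * q j) f g x y = k * lin n p f x * lin n q g y"
  by (simp add: tens_def lin_def sum_product sum_distrib_left mult_ac)

text \<open>Telescoping of \<open>(l + 1) * x ^ l\<close>.\<close>

lemma sum_dbub: "(\<Sum>l<i. dbub l x) = 1 - (real i + 1) * x ^ i"
  by (induction i) (simp_all add: dbub_def algebra_simps)

lemma lin_dbub_initial:
  assumes "i \<le> n"
  shows "lin n (\<lambda>l. of_bool (l < i)) dbub x = 1 - (real i + 1) * x ^ i"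
proof -
  have "lin n (\<lambda>l. of_bool (l < i)) dbub x = (\<Sum>l\<in>{..<n}. if l \<in> {..<i} then dbub l x else 0)"
    unfolding lin_def by (intro sum.cong) auto
  also have "\<dots> = (\<Sum>l\<in>{..<n} \<inter> {..<i}. dbub l x)"
    by (simp add: sum.inter_restrict)
  also have "{..<n} \<inter> {..<i} = {..<i}" using assms by auto
  finally show ?thesis by (simp add: sum_dbub)
qed

lemma lin_cmult: "lin n (\<lambda>i. k * c i) f x = k * lin n c f x"
  by (simp add: lin_def sum_distrib_left mult_ac)

lemma tens_eq_sum_pairs: "tens N c f g x y = (\<Sum>(i, j)\<in>{..<N} \<times> {..<N}. c i j * f i x * g j y)"
  by (simp add: tens_def sum.cartesian_product)

text \<open>Since \<open>(i + 1) x^i = 1 - (\<Sum>l<i. dbub l x)\<close>, expanding the product of two such factors gives a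
  combination of products of bubble derivatives plus the constant \<open>1\<close>, and the constants cancel.\<close>

lemma mixed_surj:
  assumes "(\<Sum>i<Suc n. \<Sum>j<Suc n. \<beta> i j) = 0"
  obtains c a b where "\<And>x y. mixed n c a b x y =
    tens (Suc n) (\<lambda>i j. \<beta> i j * (real i + 1) * (real j + 1)) mon mon x y"
proof
  fix x y
  let ?S = "{..<Suc n} \<times> {..<Suc n}"
  let ?\<beta> = "\<lambda>s. \<beta> (fst s) (snd s)"
  \<comment> \<open>By \<open>lin_dbub_initial\<close>, the indicator of \<open>l < i\<close> gives
    the coefficients of \<open>1 - (i + 1) * x ^ i\<close> in the bubble derivatives.\<close>
  let ?c = "\<lambda>l m. \<Sum>s\<in>?S. ?\<beta> s * of_bool (l < fst s) * of_bool (m < snd s)"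
  let ?a = "\<lambda>m. \<Sum>s\<in>?S. - ?\<beta> s * of_bool (m < snd s)"
  let ?b = "\<lambda>l. \<Sum>s\<in>?S. - ?\<beta> s * of_bool (l < fst s)"
  have 0: "(\<Sum>s\<in>?S. ?\<beta> s) = 0"
    using assms by (simp only: sum.cartesian_product case_prod_unfold)
  have "mixed n ?c ?a ?b x y = (\<Sum>s\<in>?S. ?\<beta> s * (1 - (real (fst s) + 1) * x ^ fst s) * (1 - (real (snd s) + 1) * y ^ snd s)
      + - ?\<beta> s * (1 - (real (snd s) + 1) * y ^ snd s) + - ?\<beta> s * (1 - (real (fst s) + 1) * x ^ fst s))"
    unfolding mixed_def tens_sum lin_sum tens_prod lin_cmult sum.distrib
    by (intro arg_cong2[where f = "(+)"] sum.cong refl) (auto simp: lin_dbub_initial less_Suc_eq_le)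
  \<comment> \<open>With P = 1 - X and Q = 1 - Y one has PQ - P - Q = XY - 1.\<close>
  also have "\<dots> = (\<Sum>s\<in>?S. ?\<beta> s * (real (fst s) + 1) * (real (snd s) + 1) * x ^ fst s * y ^ snd s - ?\<beta> s)"
    by (intro sum.cong refl) algebra
  also have "\<dots> = tens (Suc n) (\<lambda>i j. \<beta> i j * (real i + 1) * (real j + 1)) mon mon x y"
    using 0 by (simp only: tens_eq_sum_pairs sum_subtractf case_prod_unfold diff_zero)
  finally show "mixed n ?c ?a ?b x y = tens (Suc n) (\<lambda>i j. \<beta> i j * (real i + 1) * (real j + 1)) mon mon x y" .
qed

lemma sum_wt_bcoef: "n \<noteq> 0 \<Longrightarrow> (\<Sum>j\<le>n. wt n j * bcoef n j) > 0"
proof -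
  assume n: "n \<noteq> 0"
  have "wt n n * bcoef n n \<le> (\<Sum>j\<le>n. wt n j * bcoef n j)"
    by (rule member_le_sum) (auto simp: bcoef_def wt_def)
  moreover have "wt n n * bcoef n n > 0" using n wt_pos by (simp add: bcoef_def)
  ultimately show ?thesis by linarith
qed

lemma sum_wt_binomial: "(\<Sum>j\<le>n. wt n j * real (n choose j)) > 0"
  by (rule sum_pos) (auto simp: wt_pos)

text \<open>First \<kappa> is fixed by the mean value of the weighted equation, then A by
  \<open>mixed_surj\<close>, and finally \<open>zdiv_surj\<close> is applied to each monomial in x
  and y separately.\<close>

lemma decomposition_exists:
  "\<exists>c a b d \<kappa>. (\<forall>x y. tens (Suc n) (d n) mon mon x y = 0) \<and>
    (\<forall>j\<le>n. \<forall>x y. tens (Suc n) (\<alpha> j) mon mon x y =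
      zdiv n (\<lambda>h. tens (Suc n) (d h) mon mon x y) j + bcoef n j * mixed n c a b x y + \<kappa> * real (n choose j))"
proof -
  define L where "L = (\<Sum>j\<le>n. wt n j * bcoef n j)"
  define K where "K = (\<Sum>j\<le>n. wt n j * real (n choose j))"
  define A where "A i l = (\<Sum>j\<le>n. wt n j * \<alpha> j i l)" for i l
  \<comment> \<open>The coefficients of the constant polynomial 1.\<close>
  define \<delta> :: "nat \<Rightarrow> nat \<Rightarrow> real" where "\<delta> i l = of_bool (i = 0 \<and> l = 0)" for i l
  \<comment> \<open>Division by \<open>(i + 1) * (l + 1)\<close> integrates a monomial over the unit
    square, so the sum is the mean value of the polynomial with coefficients
    \<open>A\<close>.\<close>
  define \<kappa> where "\<kappa> = (\<Sum>i<Suc n. \<Sum>l<Suc n. A i l / ((real i + 1) * (real l + 1))) / K"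
  \<comment> \<open>Scaled so that the polynomial delivered by \<open>mixed_surj\<close> has the
    coefficients \<open>(A i l - \<kappa> * K * \<delta> i l) / L\<close>.\<close>
  define \<beta> where "\<beta> i l = (A i l - \<kappa> * K * \<delta> i l) / ((real i + 1) * (real l + 1)) / L" for i l
  have K: "K > 0" unfolding K_def by (rule sum_wt_binomial)
  have "(\<Sum>i<Suc n. \<Sum>l<Suc n. \<kappa> * K * \<delta> i l / ((real i + 1) * (real l + 1))) =
      (\<Sum>i<Suc n. if i = 0 then \<kappa> * K else 0)"
  proof (intro sum.cong refl)
    fix i
    have "(\<Sum>l<Suc n. \<kappa> * K * \<delta> i l / ((real i + 1) * (real l + 1))) = (\<Sum>l<Suc n. if l = 0 then of_bool (i = 0) * (\<kappa> * K) else 0)"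
      by (intro sum.cong refl) (auto simp: \<delta>_def)
    then show "(\<Sum>l<Suc n. \<kappa> * K * \<delta> i l / ((real i + 1) * (real l + 1))) = (if i = 0 then \<kappa> * K else 0)"
      by (simp only: sum.delta finite_lessThan) simp
  qed
  also have "\<dots> = \<kappa> * K" by (simp only: sum.delta finite_lessThan) simp
  also have "\<dots> = (\<Sum>i<Suc n. \<Sum>l<Suc n. A i l / ((real i + 1) * (real l + 1)))"
    using K by (simp add: \<kappa>_def)
  finally have mean: "(\<Sum>i<Suc n. \<Sum>l<Suc n. (A i l - \<kappa> * K * \<delta> i l) / ((real i + 1) * (real l + 1))) = 0"
    by (simp only: diff_divide_distrib sum_subtractf)
  have "(\<Sum>i<Suc n. \<Sum>l<Suc n. \<beta> i l) =
      (\<Sum>i<Suc n. \<Sum>l<Suc n. (A i l - \<kappa> * K * \<delta> i l) / ((real i + 1) * (real l + 1))) / L"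
    by (simp only: \<beta>_def sum_divide_distrib)
  with mean have "(\<Sum>i<Suc n. \<Sum>l<Suc n. \<beta> i l) = 0" by simp
  then obtain c a b where m: "\<And>x y. mixed n c a b x y =
    tens (Suc n) (\<lambda>i l. \<beta> i l * (real i + 1) * (real l + 1)) mon mon x y" by (rule mixed_surj) blast
  have \<beta>: "L * (\<beta> i l * (real i + 1) * (real l + 1)) = A i l - \<kappa> * K * \<delta> i l" if "i < Suc n" "l < Suc n" for i l
  proof (cases "n = 0") \<comment> \<open>then \<open>L = 0\<close> and \<open>\<beta> = 0\<close> by division by zero\<close>
    case True
    then show ?thesis using that mean by (simp add: L_def bcoef_def)
  next
    case False
    then have "L > 0" unfolding L_def by (rule sum_wt_bcoef)
    moreover have "(real i + 1) * (real l + 1) \<noteq> 0" by (simp add: add_eq_0_iff)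
    ultimately show ?thesis by (simp add: \<beta>_def)
  qed
  \<comment> \<open>What is left for \<open>zdiv\<close> to produce; its weighted sum vanishes by
    the choice of \<beta>.\<close>
  define g where "g i l j = \<alpha> j i l - bcoef n j * (\<beta> i l * (real i + 1) * (real l + 1)) - \<kappa> * real (n choose j) * \<delta> i l" for i l j
  have "\<exists>e. e n = 0 \<and> (\<forall>j\<le>n. zdiv n e j = g i l j)" if "i < Suc n" "l < Suc n" for i l
  proof (rule zdiv_surj)
    have "(\<Sum>j\<le>n. wt n j * g i l j) = A i l - L * (\<beta> i l * (real i + 1) * (real l + 1)) - \<kappa> * K * \<delta> i l"
      unfolding g_def A_def L_def K_def right_diff_distrib sum_subtractf sum_distrib_right sum_distrib_left
      by (simp only: mult_ac)
    then show "(\<Sum>j\<le>n. wt n j * g i l j) = 0" using \<beta>[OF that] by simp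
  qed
  then obtain E where E: "\<And>i l. i < Suc n \<Longrightarrow> l < Suc n \<Longrightarrow> E i l n = 0 \<and> (\<forall>j\<le>n. zdiv n (E i l) j = g i l j)"
    by metis
  have one: "tens (Suc n) \<delta> mon mon x y = 1" for x y
  proof -
    have "tens (Suc n) \<delta> mon mon x y = (\<Sum>i<Suc n. if i = 0 then 1 else 0)"
      unfolding tens_def
    proof (intro sum.cong refl)
      fix i
      have "(\<Sum>l<Suc n. \<delta> i l * x ^ i * y ^ l) = (\<Sum>l<Suc n. if l = 0 then of_bool (i = 0) else 0)"
        by (intro sum.cong refl) (cases "i = 0"; auto simp: \<delta>_def)
      then show "(\<Sum>l<Suc n. \<delta> i l * x ^ i * y ^ l) = (if i = 0 then 1 else 0)"
        by (simp only: sum.delta finite_lessThan) simp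
    qed
    then show ?thesis by (simp only: sum.delta finite_lessThan) simp
  qed
  show ?thesis
  proof (rule exI[of _ c], rule exI[of _ a], rule exI[of _ b], rule exI[of _ "\<lambda>h i l. E i l h"], rule exI[of _ \<kappa>],
      intro conjI allI impI)
    show "tens (Suc n) (\<lambda>i l. E i l n) mon mon x y = 0" for x y
      unfolding tens_def using E by (intro sum.neutral ballI) auto
    fix j x y assume j: "j \<le> n"
    have "tens (Suc n) (\<alpha> j) mon mon x y = tens (Suc n) (\<lambda>i l. zdiv n (E i l) j) mon mon x y
      + bcoef n j * mixed n c a b x y + \<kappa> * real (n choose j) * tens (Suc n) \<delta> mon mon x y"
      unfolding m tens_def sum_distrib_left sum.distrib[symmetric]
    proof (intro sum.cong refl)
      fix i l assume "i \<in> {..<Suc n}" "l \<in> {..<Suc n}"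
      then have "zdiv n (E i l) j = g i l j" using E j by simp
      then have \<alpha>: "\<alpha> j i l = zdiv n (E i l) j + bcoef n j * (\<beta> i l * (real i + 1) * (real l + 1))
        + \<kappa> * real (n choose j) * \<delta> i l" by (simp add: g_def)
      show "\<alpha> j i l * x ^ i * y ^ l = zdiv n (E i l) j * x ^ i * y ^ l +
         bcoef n j * (\<beta> i l * (real i + 1) * (real l + 1) * x ^ i * y ^ l) +
         \<kappa> * real (n choose j) * (\<delta> i l * x ^ i * y ^ l)"
        unfolding \<alpha> by (simp only: distrib_right mult.assoc)
    qed
    then show "tens (Suc n) (\<alpha> j) mon mon x y =
      zdiv n (\<lambda>h. tens (Suc n) (\<lambda>i l. E i l h) mon mon x y) j + bcoef n j * mixed n c a b x y + \<kappa> * real (n choose j)"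
      by (simp add: one zdiv_tens)
  qed
qed

section \<open>Uniqueness for the coefficient equations\<close>

lemma deriv_eq_0_on_unit:
  assumes "\<And>x. x \<in> {0..1} \<Longrightarrow> (f has_real_derivative f' x) (at x)"
    and "\<And>x. x \<in> {0..1} \<Longrightarrow> f x = 0" and x: "x \<in> {0..1}"
  shows "f' x = 0"
proof -
  \<comment> \<open>\<open>f\<close> is known to vanish only on the closed interval; at its
    endpoints the one-sided derivative still determines \<open>f'\<close>.\<close>
  have "(f has_vector_derivative f' x) (at x within cbox 0 1)"
    using assms(1)[OF x] has_real_derivative_iff_has_vector_derivative has_vector_derivative_at_within by blast
  moreover have "(f has_vector_derivative 0) (at x within cbox 0 1)"
    by (rule has_vector_derivative_transform[OF _ _ has_vector_derivative_const[of 0]]) (use assms in auto)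
  ultimately show ?thesis using x
    by (intro vector_derivative_unique_within_closed_interval[of 0 1 x f]) auto
qed

lemma linear_of_const_deriv:
  assumes "\<And>x. x \<in> {0..1} \<Longrightarrow> (f has_real_derivative m) (at x)" and "f 0 = 0" and x: "x \<in> {0..1::real}"
  shows "f x = m * x"
proof -
  have "\<exists>c. \<forall>x\<in>{0..1}. f x - m * x = c"
  proof (rule has_field_derivative_zero_constant)
    show "((\<lambda>x. f x - m * x) has_real_derivative 0) (at x within {0..1})" if "x \<in> {0..1}" for x
      by (rule has_field_derivative_at_within) (use assms(1)[OF that] in \<open>auto intro!: derivative_eq_intros\<close>)
  qed simp
  then obtain c where c: "\<forall>x\<in>{0..1}. f x - m * x = c" by blast
  from bspec[OF c, of 0] bspec[OF c x] assms(2) show ?thesis by simp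
qed

text \<open>F = r + x s + y t has mixed derivative \<open>m\<close> and vanishes on x = 0, and its
  x-derivative vanishes on y = 0, so F = m x y. The value at (1, 1) gives
  \<open>m = 0\<close>.\<close>

lemma mixed_const_imp:
  assumes "\<And>x y. x \<in> {0..1} \<Longrightarrow> y \<in> {0..1} \<Longrightarrow> mixed n c a b x y = m" and "n > 0"
  shows "m = 0 \<and> (\<forall>x\<in>{0..1}. \<forall>y\<in>{0..1}. tens n c bub bub x y = 0 \<and> lin n a bub y = 0 \<and> lin n b bub x = 0)"
proof -
  define F where "F x y = tens n c bub bub x y + x * lin n a bub y + y * lin n b bub x" for x y
  define Fx where "Fx x y = tens n c dbub bub x y + lin n a bub y + y * lin n b dbub x" for x y
  have b0: "tens n c f bub x 0 = 0" "tens n c f bub x 1 = 0" "tens n c bub f 0 x = 0" "tens n c bub f 1 x = 0"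
    "lin n a bub 0 = 0" "lin n a bub 1 = 0" for f x a
    by (simp_all add: tens_def lin_def)
  have Fx: "Fx x y = m * y" if xy: "x \<in> {0..1}" "y \<in> {0..1}" for x y
  proof (rule linear_of_const_deriv[OF _ _ xy(2)])
    show "(Fx x has_real_derivative m) (at y)" if "y \<in> {0..1}" for y
      unfolding Fx_def[abs_def]
      by (rule DERIV_cong, rule DERIV_add[OF DERIV_add[OF tens_deriv2 lin_deriv] DERIV_cmult_right[OF DERIV_ident]],
        rule bub_deriv, rule bub_deriv) (simp add: assms(1)[OF xy(1) that, symmetric] mixed_def)
    show "Fx x 0 = 0" by (simp add: Fx_def b0)
  qed
  have F: "F x y = m * y * x" if xy: "x \<in> {0..1}" "y \<in> {0..1}" for x y
  proof (rule linear_of_const_deriv[OF _ _ xy(1)])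
    show "((\<lambda>x. F x y) has_real_derivative m * y) (at x)" if "x \<in> {0..1}" for x
      unfolding F_def
      by (rule DERIV_cong, rule DERIV_add[OF DERIV_add[OF tens_deriv1 DERIV_cmult_right[OF DERIV_ident]] DERIV_cmult[OF lin_deriv]],
        rule bub_deriv, rule bub_deriv) (simp add: Fx[OF that xy(2), symmetric] Fx_def)
    show "F 0 y = 0" by (simp add: F_def b0)
  qed
  have m: "m = 0" using F[of 1 1] by (simp add: F_def b0)
  \<comment> \<open>On the edge x = 1 only s survives in F, and on y = 1 only t.\<close>
  have a: "lin n a bub y = 0" if "y \<in> {0..1}" for y using F[of 1 y] that by (simp add: F_def b0 m)
  have b: "lin n b bub x = 0" if "x \<in> {0..1}" for x using F[of x 1] that by (simp add: F_def b0 m)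
  show ?thesis using m a b F by (auto simp: F_def)
qed

text \<open>To be applied to the difference of two solutions. Uniqueness concerns fields, so the
  conclusion lists the functions that make up \<open>vfield\<close>, on the unit square.\<close>

lemma decomposition_trivial:
  assumes E: "\<And>x y j. x \<in> {0..1} \<Longrightarrow> y \<in> {0..1} \<Longrightarrow> j \<le> n \<Longrightarrow>
      zdiv n (E x y) j + bcoef n j * mixed n c a b x y + \<kappa> * real (n choose j) = 0"
    and En: "\<And>x y. x \<in> {0..1} \<Longrightarrow> y \<in> {0..1} \<Longrightarrow> E x y n = 0"
  shows "\<kappa> = 0" and "\<And>x y. x \<in> {0..1} \<Longrightarrow> y \<in> {0..1} \<Longrightarrow>
    tens n c dbub bub x y = 0 \<and> tens n c bub dbub x y = 0 \<and> lin n a bub y = 0 \<and> lin n b bub x = 0 \<and>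
    mixed n c a b x y = 0 \<and> (\<forall>h\<le>n. E x y h = 0)"
proof -
  define L where "L = (\<Sum>j\<le>n. wt n j * bcoef n j)"
  define K where "K = (\<Sum>j\<le>n. wt n j * real (n choose j))"
  have K: "K > 0" unfolding K_def by (rule sum_wt_binomial)
  have eq: "L * mixed n c a b x y + \<kappa> * K = 0" if xy: "x \<in> {0..1}" "y \<in> {0..1}" for x y
  proof -
    have "0 = (\<Sum>j\<le>n. wt n j * (zdiv n (E x y) j + bcoef n j * mixed n c a b x y + \<kappa> * real (n choose j)))"
      using E[OF xy] by simp
    also have "\<dots> = (\<Sum>j\<le>n. wt n j * zdiv n (E x y) j) + L * mixed n c a b x y + \<kappa> * K"
      unfolding L_def K_def by (simp add: distrib_left sum.distrib sum_distrib_left sum_distrib_right mult_ac)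
    finally show ?thesis using sum_wt_zdiv[of n n "E x y"] En[OF xy] by simp
  qed
  have main: "\<kappa> = 0 \<and> (\<forall>x\<in>{0..1}. \<forall>y\<in>{0..1}. tens n c bub bub x y = 0 \<and> lin n a bub y = 0 \<and> lin n b bub x = 0 \<and>
    mixed n c a b x y = 0)"
  proof (cases "n = 0")
    case True
    \<comment> \<open>There are no bubbles, and the weighted equation reduces to
      \<open>\<kappa> * K = 0\<close>.\<close>
    then have "L = 0" by (simp add: L_def bcoef_def)
    then have "\<kappa> = 0" using eq[of 0 0] K by simp
    then show ?thesis by (simp add: True tens_def lin_def mixed_def)
  next
    case False
    then have L: "L > 0" unfolding L_def by (rule sum_wt_bcoef)
    have m: "mixed n c a b x y = - \<kappa> * K / L" if "x \<in> {0..1}" "y \<in> {0..1}" for x y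
      using eq[OF that] L by (simp add: field_simps)
    from mixed_const_imp[OF this] False have *: "- \<kappa> * K / L = 0"
      "\<forall>x\<in>{0..1}. \<forall>y\<in>{0..1}. tens n c bub bub x y = 0 \<and> lin n a bub y = 0 \<and> lin n b bub x = 0"
      by auto
    then show ?thesis using m K L by simp
  qed
  then show k: "\<kappa> = 0" by simp
  fix x y :: real assume xy: "x \<in> {0..1}" "y \<in> {0..1}"
  have "tens n c dbub bub x y = 0"
    by (rule deriv_eq_0_on_unit[of "\<lambda>x. tens n c bub bub x y"]) (use main xy in \<open>auto intro!: tens_deriv1 bub_deriv\<close>)
  moreover have "tens n c bub dbub x y = 0"
    by (rule deriv_eq_0_on_unit[of "\<lambda>y. tens n c bub bub x y"]) (use main xy in \<open>auto intro!: tens_deriv2 bub_deriv\<close>)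
  moreover have "E x y h = 0" if "h \<le> n" for h
    using E[OF xy] main xy k that by (intro zdiv_eq_0_imp[of n "E x y" h]) simp_all
  ultimately show "tens n c dbub bub x y = 0 \<and> tens n c bub dbub x y = 0 \<and> lin n a bub y = 0 \<and> lin n b bub x = 0 \<and>
    mixed n c a b x y = 0 \<and> (\<forall>h\<le>n. E x y h = 0)"
    using main xy by simp
qed

section \<open>The decomposition\<close>

lemma int_le_set:
  "{i. int i \<le> int (Suc n) - 1} = {..<Suc n}" "{i. int i \<le> int (Suc n) - 2} = {..<n}"
  by auto

lemma poly1_eq: "poly1 (int (Suc n) - 2) = {lin n c mon | c. True}"
  unfolding poly1_def int_le_set lin_def[abs_def] by (simp only: simp_thms)

lemma poly2_eq: "poly2 (int (Suc n) - 2) (int (Suc n) - 2) = {tens n c mon mon | c. True}"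
  unfolding poly2_def int_le_set tens_def[abs_def] by (simp only: simp_thms)

lemma poly3_sum_swap:
  "(\<Sum>i<N. \<Sum>j<N. \<Sum>h\<in>H. c i j h * x ^ i * y ^ j * z ^ h) =
    (\<Sum>h\<in>H. tens N (\<lambda>i j. c i j h) mon mon x y * z ^ h)"
proof -
  have "(\<Sum>i<N. \<Sum>j<N. \<Sum>h\<in>H. c i j h * x ^ i * y ^ j * z ^ h) =
      (\<Sum>i<N. \<Sum>h\<in>H. \<Sum>j<N. c i j h * x ^ i * y ^ j * z ^ h)"
    by (intro sum.cong refl sum.swap)
  also have "\<dots> = (\<Sum>h\<in>H. \<Sum>i<N. \<Sum>j<N. c i j h * x ^ i * y ^ j * z ^ h)"
    by (rule sum.swap)
  finally show ?thesis by (simp only: tens_def sum_distrib_right)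
qed

text \<open>The bound \<open>int N - 1\<close> covers both vertical degrees that occur:
  \<open>N = Suc n\<close> for the 3-forms and \<open>N = n\<close> for the third component.\<close>

lemma poly3_eq:
  "poly3 (int (Suc n) - 1) (int (Suc n) - 1) (int N - 1) =
    {(\<lambda>x y z. \<Sum>h<N. tens (Suc n) (d h) mon mon x y * z ^ h) | d. True}"
proof -
  have N: "{i. int i \<le> int N - 1} = {..<N}" by auto
  show ?thesis
    unfolding poly3_def int_le_set N poly3_sum_swap
  proof (intro equalityI subsetI; elim CollectE exE conjE)
    fix u c assume "u = (\<lambda>x y z. \<Sum>h<N. tens (Suc n) (\<lambda>i j. c i j h) mon mon x y * z ^ h)"
    then show "u \<in> {(\<lambda>x y z. \<Sum>h<N. tens (Suc n) (d h) mon mon x y * z ^ h) | d. True}"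
      by (intro CollectI exI[of _ "\<lambda>h i j. c i j h"] conjI TrueI)
  next
    fix u d assume "u = (\<lambda>x y z. \<Sum>h<N. tens (Suc n) (d h) mon mon x y * z ^ h)"
    then show "u \<in> {u. \<exists>c. u = (\<lambda>x y z. \<Sum>h<N. tens (Suc n) (\<lambda>i j. c i j h) mon mon x y * z ^ h)}"
      by (intro CollectI exI[of _ "\<lambda>i j h. d h i j"])
  qed
qed

lemma Collect_Collect:
  "{G f | f. f \<in> {H d | d. True}} = {G (H d) | d. True}"
  by blast

lemma Qspace_eq:
  "Qspace K (int (Suc n) - 1) (int (Suc n) - 1) (int N - 1) =
    {(\<lambda>x y z. (\<Sum>h<N. tens (Suc n) (d h) mon mon x y * z ^ h) / (1 + z) ^ K) | d. True}"
  unfolding Qspace_def poly3_eq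
  by (rule Collect_Collect[where G = "\<lambda>u x y z. u x y z / (1 + z) ^ K" and
      H = "\<lambda>d x y z. \<Sum>h<N. tens (Suc n) (d h) mon mon x y * z ^ h"])

lemma image_Collect_Collect:
  "F ` {G f | f. f \<in> {H d | d. True}} = {F (G (H d)) | d. True}"
  by blast

lemma U3_eq: "U3 (Suc n) = {inv_pullback3 (restrict (\<lambda>p.
    (\<Sum>j\<le>n. tens (Suc n) (\<alpha> j) mon mon (p$1) (p$2) * p$3 ^ j) / (1 + p$3) ^ (n + 4)) inf_pyramid) | \<alpha>. True}"
proof -
  have k: "Suc n + 3 = n + 4" by simp
  show ?thesis
    unfolding U3_def k Qspace_eq[of _ n "Suc n"] lessThan_Suc_atMost
    by (rule image_Collect_Collect[where G = "\<lambda>f. \<lambda>p\<in>inf_pyramid. f (p$1) (p$2) (p$3)" and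
        H = "\<lambda>d x y z. (\<Sum>h\<le>n. tens (Suc n) (d h) mon mon x y * z ^ h) / (1 + z) ^ (n + 4)"])
qed

text \<open>The field does not depend on \<open>d n\<close>, so this coefficient can be normalized
  to 0, as \<open>zdiv\<close> requires.\<close>

lemma U2_0div_eq: "U2_0div (Suc n) = {inv_pullback2 (restrict
    (vfield n c a b (\<lambda>h. tens (Suc n) (d h) mon mon)) inf_pyramid) | c a b d.
    \<forall>x y. tens (Suc n) (d n) mon mon x y = 0}" (is "_ = ?R")
proof -
  have r: "(\<lambda>x y. x * (1 - x) * y * (1 - y) * tens n c mon mon x y) = tens n c bub bub" for c
    by (simp add: tens_def sum_distrib_left bub_def fun_eq_iff mult_ac)
  have l: "(\<lambda>x. x * (1 - x) * lin n c mon x) = lin n c bub" for c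
    by (simp add: lin_def sum_distrib_left bub_def fun_eq_iff mult_ac)
  have R: "(\<exists>p\<in>poly2 (int (Suc n) - 2) (int (Suc n) - 2). r = (\<lambda>x y. x * (1 - x) * y * (1 - y) * p x y)) \<longleftrightarrow>
    (\<exists>c. r = tens n c bub bub)" for r
    unfolding poly2_eq r[symmetric] by blast
  have S: "(\<exists>p\<in>poly1 (int (Suc n) - 2). s = (\<lambda>x. x * (1 - x) * p x)) \<longleftrightarrow> (\<exists>c. s = lin n c bub)" for s
    unfolding poly1_eq l[symmetric] by blast
  have int: "int (Suc n) - 2 = int n - 1" and k: "Suc n + 2 = n + 3" by simp_all
  have X: "f \<in> Qspace (Suc n + 2) (int (Suc n) - 1) (int (Suc n) - 1) (int (Suc n) - 2) \<longleftrightarrow>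
      (\<exists>d. f = chi n (\<lambda>h. tens (Suc n) (d h) mon mon))" for f
    unfolding int k Qspace_eq chi_def[abs_def] by blast
  have "U2_0div (Suc n) = {inv_pullback2 (div_field (Suc n) (tens n c bub bub) (lin n a bub) (lin n b bub)
      (chi n (\<lambda>h. tens (Suc n) (d h) mon mon))) | c a b d. True}"
    unfolding U2_0div_def R S X by blast
  also have "\<dots> = {inv_pullback2 (restrict
    (vfield n c a b (\<lambda>h. tens (Suc n) (d h) mon mon)) inf_pyramid) | c a b d. True}"
    unfolding div_field_eq ..
  also have "\<dots> = ?R"
  proof (intro equalityI subsetI)
    fix w assume "w \<in> {inv_pullback2 (restrict
      (vfield n c a b (\<lambda>h. tens (Suc n) (d h) mon mon)) inf_pyramid) | c a b d. True}"
    then obtain c a b d where w: "w = inv_pullback2 (restrict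
      (vfield n c a b (\<lambda>h. tens (Suc n) (d h) mon mon)) inf_pyramid)" by blast
    let ?d = "d(n := \<lambda>i j. 0)"
    have eq: "vfield n c a b (\<lambda>h. tens (Suc n) (d h) mon mon) = vfield n c a b (\<lambda>h. tens (Suc n) (?d h) mon mon)"
      by (simp add: vfield_def fun_eq_iff)
    have "\<forall>x y. tens (Suc n) (?d n) mon mon x y = 0" by (simp add: tens_def)
    then show "w \<in> ?R" unfolding w eq by blast
  qed blast
  finally show ?thesis .
qed

text \<open>After transport by \<open>phi\<close> and multiplication by \<open>(1 + z) ^ n\<close>
  both sides are polynomials in z, the constant \<kappa> turning into
  \<open>\<kappa> * (1 + z) ^ n\<close>. Comparing coefficients at each point of the unit square
  gives the system.\<close>

lemma decomposition_iff:
  assumes u: "u = inv_pullback3 (restrict (\<lambda>p.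
      (\<Sum>j\<le>n. tens (Suc n) (\<alpha> j) mon mon (p$1) (p$2) * p$3 ^ j) / (1 + p$3) ^ (n + 4)) inf_pyramid)"
    and w: "w = inv_pullback2 (restrict (vfield n c a b (\<lambda>h. tens (Suc n) (d h) mon mon)) inf_pyramid)"
    and d: "\<And>x y. tens (Suc n) (d n) mon mon x y = 0"
  shows "(\<forall>q\<in>pyramid - {apex}. u q = divergence w q + \<kappa>) \<longleftrightarrow>
    (\<forall>x\<in>{0..1}. \<forall>y\<in>{0..1}. \<forall>j\<le>n. tens (Suc n) (\<alpha> j) mon mon x y =
      zdiv n (\<lambda>h. tens (Suc n) (d h) mon mon x y) j + bcoef n j * mixed n c a b x y + \<kappa> * real (n choose j))"
proof -
  define f where "f x y j = tens (Suc n) (\<alpha> j) mon mon x y" for x y j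
  define g where "g x y j = zdiv n (\<lambda>h. tens (Suc n) (d h) mon mon x y) j + bcoef n j * mixed n c a b x y" for x y j
  have pointwise: "u (phi p) = divergence w (phi p) + \<kappa> \<longleftrightarrow>
      (\<Sum>j\<le>n. f (p$1) (p$2) j * p$3 ^ j) = (\<Sum>j\<le>n. (g (p$1) (p$2) j + \<kappa> * real (n choose j)) * p$3 ^ j)"
    if p: "p \<in> inf_pyramid" for p
  proof -
    have pos: "1 + p$3 > 0" using p by (simp add: inf_pyramid_def)
    have binom: "\<kappa> * (1 + p$3) ^ n = (\<Sum>j\<le>n. \<kappa> * real (n choose j) * p$3 ^ j)"
      using binomial_ring[of "p$3" 1 n] by (simp add: add.commute sum_distrib_left mult_ac)
    have uphi: "u (phi p) * (1 + p$3) ^ n = (\<Sum>j\<le>n. f (p$1) (p$2) j * p$3 ^ j)"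
      using pos unfolding u inv_pullback3_phi[OF p] f_def by (simp add: power_add)
    have wphi: "divergence w (phi p) * (1 + p$3) ^ n = (\<Sum>j\<le>n. g (p$1) (p$2) j * p$3 ^ j)"
      using pos unfolding w divergence_vfield[where e = "\<lambda>h. tens (Suc n) (d h) mon mon" and d = d, OF p refl d] g_def by (simp add: power_add)
    have "u (phi p) = divergence w (phi p) + \<kappa> \<longleftrightarrow>
        u (phi p) * (1 + p$3) ^ n = (divergence w (phi p) + \<kappa>) * (1 + p$3) ^ n"
      using pos by simp
    then show ?thesis
      by (simp only: distrib_right uphi wphi binom sum.distrib)
  qed
  have "(\<forall>q\<in>pyramid - {apex}. u q = divergence w q + \<kappa>) \<longleftrightarrow>
      (\<forall>p\<in>inf_pyramid. u (phi p) = divergence w (phi p) + \<kappa>)"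
    unfolding bij_betw_imp_surj_on[OF bij_betw_phi, symmetric] by (rule ball_simps)
  also have "\<dots> \<longleftrightarrow> (\<forall>p\<in>inf_pyramid. (\<Sum>j\<le>n. f (p$1) (p$2) j * p$3 ^ j) =
      (\<Sum>j\<le>n. (g (p$1) (p$2) j + \<kappa> * real (n choose j)) * p$3 ^ j))"
    by (intro ball_cong refl pointwise)
  also have "\<dots> \<longleftrightarrow> (\<forall>x\<in>{0..1}. \<forall>y\<in>{0..1}. \<forall>z\<ge>0. (\<Sum>j\<le>n. f x y j * z ^ j) =
      (\<Sum>j\<le>n. (g x y j + \<kappa> * real (n choose j)) * z ^ j))" (is "?A \<longleftrightarrow> ?B")
  proof
    assume A: ?A
    show ?B
    proof (intro ballI allI impI)
      fix x y z :: real assume "x \<in> {0..1}" "y \<in> {0..1}" "z \<ge> 0"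
      then have "vector [x, y, z] \<in> inf_pyramid" by (simp add: inf_pyramid_def)
      from bspec[OF A this] show "(\<Sum>j\<le>n. f x y j * z ^ j) = (\<Sum>j\<le>n. (g x y j + \<kappa> * real (n choose j)) * z ^ j)"
        by (simp only: vector_3)
    qed
  qed (auto simp: inf_pyramid_def)
  also have "\<dots> \<longleftrightarrow> (\<forall>x\<in>{0..1}. \<forall>y\<in>{0..1}. \<forall>j\<le>n. f x y j = g x y j + \<kappa> * real (n choose j))"
  proof -
    have "(\<forall>z\<ge>0::real. (\<Sum>j\<le>n. s j * z ^ j) = (\<Sum>j\<le>n. t j * z ^ j)) \<longleftrightarrow> (\<forall>j\<le>n. s j = t j)" for s t
    proof
      assume "\<forall>z\<ge>0::real. (\<Sum>j\<le>n. s j * z ^ j) = (\<Sum>j\<le>n. t j * z ^ j)"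
      \<comment> \<open>A polynomial with a nonzero coefficient has only finitely many
        roots.\<close>
      then have "{0..1} \<subseteq> {z. (\<Sum>j\<le>n. (s j - t j) * z ^ j) = 0}"
        by (auto simp: left_diff_distrib sum_subtractf)
      then have "infinite {z. (\<Sum>j\<le>n. (s j - t j) * z ^ j) = 0}"
        by (rule infinite_super) (simp add: infinite_Icc)
      then show "\<forall>j\<le>n. s j = t j" by (simp add: polyfun_finite_roots)
    qed simp
    then show ?thesis by simp
  qed
  finally show ?thesis unfolding f_def g_def .
qed

theorem lemma4p11:
  fixes k :: nat and u :: "real^3 \<Rightarrow> real"
  assumes "k \<ge> 1" and "u \<in> U3 k"
  shows "\<exists>!(w, c). w \<in> U2_0div k \<and>
    (\<forall>q \<in> pyramid - {apex}. u q = divergence w q + c)"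
proof -
  obtain n where k: "k = Suc n" using assms(1) by (cases k) auto
  obtain \<alpha> where u: "u = inv_pullback3 (restrict (\<lambda>p.
      (\<Sum>j\<le>n. tens (Suc n) (\<alpha> j) mon mon (p$1) (p$2) * p$3 ^ j) / (1 + p$3) ^ (n + 4)) inf_pyramid)"
    using assms(2) unfolding k U3_eq by blast
  obtain c a b d \<kappa> where d: "\<forall>x y. tens (Suc n) (d n) mon mon x y = 0"
    and sol: "\<forall>j\<le>n. \<forall>x y. tens (Suc n) (\<alpha> j) mon mon x y =
      zdiv n (\<lambda>h. tens (Suc n) (d h) mon mon x y) j + bcoef n j * mixed n c a b x y + \<kappa> * real (n choose j)"
    using decomposition_exists[of n \<alpha>] by (elim exE conjE)
  define W where "W = vfield n c a b (\<lambda>h. tens (Suc n) (d h) mon mon)"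
  define w where "w = inv_pullback2 (restrict W inf_pyramid)"
  have w: "w \<in> U2_0div k" unfolding k U2_0div_eq w_def W_def using d by blast
  have eq: "\<forall>q\<in>pyramid - {apex}. u q = divergence w q + \<kappa>"
    by (rule iffD2[OF decomposition_iff[OF u w_def[unfolded W_def]]]) (use d sol in simp_all)
  have "w' = w \<and> \<kappa>' = \<kappa>" if w': "w' \<in> U2_0div k" and eq': "\<forall>q\<in>pyramid - {apex}. u q = divergence w' q + \<kappa>'" for w' \<kappa>'
  proof -
    obtain c' a' b' d' where w'_def: "w' = inv_pullback2 (restrict (vfield n c' a' b' (\<lambda>h. tens (Suc n) (d' h) mon mon)) inf_pyramid)"
      and d': "\<forall>x y. tens (Suc n) (d' n) mon mon x y = 0"
      using w' unfolding k U2_0div_eq by (elim CollectE exE conjE)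
    have sol': "\<forall>x\<in>{0..1}. \<forall>y\<in>{0..1}. \<forall>j\<le>n. tens (Suc n) (\<alpha> j) mon mon x y =
        zdiv n (\<lambda>h. tens (Suc n) (d' h) mon mon x y) j + bcoef n j * mixed n c' a' b' x y + \<kappa>' * real (n choose j)"
      by (rule iffD1[OF decomposition_iff[OF u w'_def]]) (use d' eq' in simp_all)
    \<comment> \<open>The difference of the two solutions solves the homogeneous system.\<close>
    let ?E = "\<lambda>x y h. tens (Suc n) (d' h) mon mon x y - tens (Suc n) (d h) mon mon x y"
    have diff: "zdiv n (?E x y) j + bcoef n j * mixed n (\<lambda>i j. c' i j - c i j) (\<lambda>i. a' i - a i) (\<lambda>i. b' i - b i) x y +
        (\<kappa>' - \<kappa>) * real (n choose j) = 0" if "x \<in> {0..1}" "y \<in> {0..1}" "j \<le> n" for x y j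
      using sol[rule_format, OF that(3), of x y] sol'[rule_format, OF that] unfolding zdiv_diff mixed_diff
      by (simp add: algebra_simps)
    note triv = decomposition_trivial[OF diff]
    have "\<kappa>' - \<kappa> = 0" by (rule triv(1)) (simp_all add: d d')
    moreover have "restrict (vfield n c' a' b' (\<lambda>h. tens (Suc n) (d' h) mon mon)) inf_pyramid = restrict W inf_pyramid"
    proof (rule restrict_ext)
      fix p assume "p \<in> inf_pyramid"
      then have xy: "p$1 \<in> {0..1}" "p$2 \<in> {0..1}" by (simp_all add: inf_pyramid_def)
      have "tens n (\<lambda>i j. c' i j - c i j) dbub bub (p$1) (p$2) = 0 \<and> tens n (\<lambda>i j. c' i j - c i j) bub dbub (p$1) (p$2) = 0 \<and>
          lin n (\<lambda>i. a' i - a i) bub (p$2) = 0 \<and> lin n (\<lambda>i. b' i - b i) bub (p$1) = 0 \<and>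
          mixed n (\<lambda>i j. c' i j - c i j) (\<lambda>i. a' i - a i) (\<lambda>i. b' i - b i) (p$1) (p$2) = 0 \<and> (\<forall>h\<le>n. ?E (p$1) (p$2) h = 0)"
        by (rule triv(2)) (simp_all add: d d' xy[simplified])
      then show "vfield n c' a' b' (\<lambda>h. tens (Suc n) (d' h) mon mon) p = W p"
        unfolding W_def vfield_def tens_diff lin_diff mixed_diff by simp
    qed
    ultimately show ?thesis by (simp add: w_def w'_def)
  qed
  with w eq show ?thesis by (intro ex1I[of _ "(w, \<kappa>)"]) auto
qed

end
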